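(* Let $b\ge 1$ and let $v=(v_{ij})_{i,j=1}^b\in M_b(U_b^{\mathrm{nc}})$ be the canonical Haar unitary matrix over the Brown algebra, considered in $(M_b(U_b^{\mathrm{nc}}),\Phi)$ with $\Phi((a_{ij}))=\frac1b\sum_i\varphi(a_{ii})$. Then its transpose $v^t=(v_{ji})_{i,j=1}^b$ has the same $*$-distribution as $b^{-1}(u_1+\cdots+u_{b^2})$, where $u_1,\dots,u_{b^2}$ are $b^2$ $*$-free Haar unitaries (in some $*$-probability space).
   Context: **Brown algebra.** Let $M_b(\mathbb{C})*C(\mathbb{T})$ be the (unital) free product $C^*$-algebra, with tracial state $\varphi_b$ equal to the free product of the normalized trace on $M_b(\mathbb{C})$ and integration against normalized Haar measure on $C(\mathbb{T})$. Let $\{e_{ij}\}$ be the matrix units of $M_b(\mathbb{C})$ and let $v\in C(\mathbb{T})$, $v(z)=z$ (a Haar unitary, $*$-free from the $e_{ij}$). Set $U_b^{\mathrm{nc}}=e_{11}(M_b(\mathbb{C})*C(\mathbb{T}))e_{11}$, $v_{ij}=e_{1i}\,v\,e_{j1}\in U_b^{\mathrm{nc}}$, and $\varphi(x)=b\,\varphi_b(x)$ for $x\in U_b^{\mathrm{nc}}$ (a tracial state). The algebra $M_b(\mathbb{C})*C(\mathbb{T})$ is identified with $M_b(U_b^{\mathrm{nc}})$ via $x\mapsto(e_{1i}xe_{j1})_{i,j}$, so that $v=(v_{ij})_{i,j=1}^b$ is a unitary matrix. A Haar unitary is a unitary $u$ whose moments satisfy $\psi(u^k)=0$ for all nonzero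 integers $k$, where $\psi$ is the state of the ambient space. *)

theory Defs
  imports "HOL-Analysis.Henstock_Kurzweil_Integration" "HOL-Library.Nonpos_Ints"
    "HOL-Algebra.Module"
begin

section \<open>Unital *-algebras and C*-algebras over the complex numbers\<close>

record 'a star_algebra = "(complex, 'a) module" +
  star :: "'a \<Rightarrow> 'a"

definition complex_algebra :: "complex star_algebra" where
  "complex_algebra = \<lparr>carrier = UNIV, mult = (*), one = 1, zero = 0, add = (+),
     smult = (*), star = cnj\<rparr>"

locale star_algebra = ring A + Module.module complex_algebra A
  for A :: "('a, 'm) star_algebra_scheme" (structure) +
  assumes smult_mult_left:
      "x \<in> carrier A \<Longrightarrow> y \<in> carrier A \<Longrightarrow> (c \<odot> x) \<otimes> y = c \<odot> (x \<otimes> y)"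
    and smult_mult_right:
      "x \<in> carrier A \<Longrightarrow> y \<in> carrier A \<Longrightarrow> x \<otimes> (c \<odot> y) = c \<odot> (x \<otimes> y)"
    and star_closed: "x \<in> carrier A \<Longrightarrow> star A x \<in> carrier A"
    and star_star: "x \<in> carrier A \<Longrightarrow> star A (star A x) = x"
    and star_add:
      "x \<in> carrier A \<Longrightarrow> y \<in> carrier A \<Longrightarrow> star A (x \<oplus> y) = star A x \<oplus> star A y"
    and star_mult:
      "x \<in> carrier A \<Longrightarrow> y \<in> carrier A \<Longrightarrow> star A (x \<otimes> y) = star A y \<otimes> star A x"
    and star_smult: "x \<in> carrier A \<Longrightarrow> star A (c \<odot> x) = cnj c \<odot> star A x"

record 'a cstar_algebra = "'a star_algebra" +
  cnorm :: "'a \<Rightarrow> real"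

locale cstar_algebra = star_algebra A
  for A :: "('a, 'm) cstar_algebra_scheme" (structure) +
  assumes cnorm_nonneg: "x \<in> carrier A \<Longrightarrow> 0 \<le> cnorm A x"
    and cnorm_eq_0: "x \<in> carrier A \<Longrightarrow> cnorm A x = 0 \<longleftrightarrow> x = \<zero>"
    and cnorm_add:
      "x \<in> carrier A \<Longrightarrow> y \<in> carrier A \<Longrightarrow> cnorm A (x \<oplus> y) \<le> cnorm A x + cnorm A y"
    and cnorm_smult: "x \<in> carrier A \<Longrightarrow> cnorm A (c \<odot> x) = norm c * cnorm A x"
    and cnorm_mult:
      "x \<in> carrier A \<Longrightarrow> y \<in> carrier A \<Longrightarrow> cnorm A (x \<otimes> y) \<le> cnorm A x * cnorm A y"
    and cnorm_star_mult: "x \<in> carrier A \<Longrightarrow> cnorm A (star A x \<otimes> x) = (cnorm A x)\<^sup>2"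
    and cnorm_complete:
      "(\<And>n::nat. s n \<in> carrier A) \<Longrightarrow>
       (\<forall>e>0. \<exists>N. \<forall>m\<ge>N. \<forall>n\<ge>N. cnorm A (s m \<ominus> s n) < e) \<Longrightarrow>
       \<exists>l\<in>carrier A. (\<lambda>n. cnorm A (s n \<ominus> l)) \<longlonglongrightarrow> 0"

definition star_hom ::
    "('a, 'm) star_algebra_scheme \<Rightarrow> ('b, 'n) star_algebra_scheme \<Rightarrow> ('a \<Rightarrow> 'b) set" where
  "star_hom A B = {h \<in> ring_hom A B. \<forall>x\<in>carrier A.
     h (star A x) = star B (h x) \<and> (\<forall>c. h (c \<odot>\<^bsub>A\<^esub> x) = c \<odot>\<^bsub>B\<^esub> h x)}"

inductive_set star_gen :: "('a, 'm) star_algebra_scheme \<Rightarrow> 'a set \<Rightarrow> 'a set"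
  for A (structure) and S where
    incl: "x \<in> S \<Longrightarrow> x \<in> star_gen A S"
  | one: "\<one> \<in> star_gen A S"
  | add: "x \<in> star_gen A S \<Longrightarrow> y \<in> star_gen A S \<Longrightarrow> x \<oplus> y \<in> star_gen A S"
  | mult: "x \<in> star_gen A S \<Longrightarrow> y \<in> star_gen A S \<Longrightarrow> x \<otimes> y \<in> star_gen A S"
  | smult: "x \<in> star_gen A S \<Longrightarrow> c \<odot> x \<in> star_gen A S"
  | star: "x \<in> star_gen A S \<Longrightarrow> star A x \<in> star_gen A S"


section \<open>*-probability spaces, *-distributions and freeness\<close>

definition star_prob_space :: "('a, 'm) star_algebra_scheme \<Rightarrow> ('a \<Rightarrow> complex) \<Rightarrow> bool" where
  "star_prob_space A \<phi> \<longleftrightarrow> star_algebra A \<and>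
     (\<forall>x\<in>carrier A. \<forall>y\<in>carrier A. \<phi> (x \<oplus>\<^bsub>A\<^esub> y) = \<phi> x + \<phi> y) \<and>
     (\<forall>c. \<forall>x\<in>carrier A. \<phi> (c \<odot>\<^bsub>A\<^esub> x) = c * \<phi> x) \<and>
     (\<forall>x\<in>carrier A. \<phi> (star A x \<otimes>\<^bsub>A\<^esub> x) \<in> \<real>\<^sub>\<ge>\<^sub>0) \<and>
     \<phi> \<one>\<^bsub>A\<^esub> = 1"

definition tracial :: "('a, 'm) star_algebra_scheme \<Rightarrow> ('a \<Rightarrow> complex) \<Rightarrow> bool" where
  "tracial A \<phi> \<longleftrightarrow> (\<forall>x\<in>carrier A. \<forall>y\<in>carrier A. \<phi> (x \<otimes>\<^bsub>A\<^esub> y) = \<phi> (y \<otimes>\<^bsub>A\<^esub> x))"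

datatype star_letter = X | X_star

fun eval_letter :: "('a, 'm) star_algebra_scheme \<Rightarrow> 'a \<Rightarrow> star_letter \<Rightarrow> 'a" where
  "eval_letter A a X = a"
| "eval_letter A a X_star = star A a"

definition eval_word :: "('a, 'm) star_algebra_scheme \<Rightarrow> 'a \<Rightarrow> star_letter list \<Rightarrow> 'a" where
  "eval_word A a w = foldr (\<lambda>l y. eval_letter A a l \<otimes>\<^bsub>A\<^esub> y) w \<one>\<^bsub>A\<^esub>"

text \<open>The *-distribution of an element is the functional it induces on noncommutative polynomials
  in a variable and its adjoint, recorded by its values on the basis of words, the *-moments.\<close>

definition star_distribution ::
    "('a, 'm) star_algebra_scheme \<Rightarrow> ('a \<Rightarrow> complex) \<Rightarrow> 'a \<Rightarrow> star_letter list \<Rightarrow> complex" where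
  "star_distribution A \<phi> a = (\<lambda>w. \<phi> (eval_word A a w))"

text \<open>Freeness of a family of unital *-subalgebras: alternating products of centred elements are
  centred.\<close>

definition free_family ::
    "('a, 'm) star_algebra_scheme \<Rightarrow> ('a \<Rightarrow> complex) \<Rightarrow> 'i set \<Rightarrow> ('i \<Rightarrow> 'a set) \<Rightarrow> bool" where
  "free_family A \<phi> I B \<longleftrightarrow>
     (\<forall>xs. xs \<noteq> [] \<longrightarrow> distinct_adj (map fst xs) \<longrightarrow>
        (\<forall>(i, x) \<in> set xs. i \<in> I \<and> x \<in> B i \<and> \<phi> x = 0) \<longrightarrow>
        \<phi> (foldr (\<lambda>(i, x) y. x \<otimes>\<^bsub>A\<^esub> y) xs \<one>\<^bsub>A\<^esub>) = 0)"

definition star_free ::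
    "('a, 'm) star_algebra_scheme \<Rightarrow> ('a \<Rightarrow> complex) \<Rightarrow> 'i set \<Rightarrow> ('i \<Rightarrow> 'a) \<Rightarrow> bool" where
  "star_free A \<phi> I a \<longleftrightarrow> free_family A \<phi> I (\<lambda>i. star_gen A {a i})"

definition haar_unitary ::
    "('a, 'm) star_algebra_scheme \<Rightarrow> ('a \<Rightarrow> complex) \<Rightarrow> 'a \<Rightarrow> bool" where
  "haar_unitary A \<phi> u \<longleftrightarrow> u \<in> carrier A \<and>
     star A u \<otimes>\<^bsub>A\<^esub> u = \<one>\<^bsub>A\<^esub> \<and> u \<otimes>\<^bsub>A\<^esub> star A u = \<one>\<^bsub>A\<^esub> \<and>
     (\<forall>k::int. k \<noteq> 0 \<longrightarrow> \<phi> (u [^]\<^bsub>A\<^esub> k) = 0)"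

definition free_haar_unitaries ::
    "('a, 'm) star_algebra_scheme \<Rightarrow> ('a \<Rightarrow> complex) \<Rightarrow> 'i set \<Rightarrow> ('i \<Rightarrow> 'a) \<Rightarrow> bool" where
  "free_haar_unitaries A \<phi> I u \<longleftrightarrow>
     star_prob_space A \<phi> \<and> (\<forall>i\<in>I. haar_unitary A \<phi> (u i)) \<and> star_free A \<phi> I u"


section \<open>Matrix algebras and continuous functions on the circle\<close>

text \<open>Matrices are indexed by pairs from \<open>1, \<dots>, b\<close>; they are extensional functions, so that
  equality of matrices is equality of functions.\<close>

definition mat_algebra ::
    "nat \<Rightarrow> ('a, 'm) star_algebra_scheme \<Rightarrow> (nat \<times> nat \<Rightarrow> 'a) star_algebra" where
  "mat_algebra b A = \<lparr>
     carrier = ({1..b} \<times> {1..b}) \<rightarrow>\<^sub>E carrier A,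
     mult = (\<lambda>S T. \<lambda>(i, j)\<in>{1..b} \<times> {1..b}. \<Oplus>\<^bsub>A\<^esub>k\<in>{1..b}. S (i, k) \<otimes>\<^bsub>A\<^esub> T (k, j)),
     one = (\<lambda>(i, j)\<in>{1..b} \<times> {1..b}. if i = j then \<one>\<^bsub>A\<^esub> else \<zero>\<^bsub>A\<^esub>),
     zero = (\<lambda>(i, j)\<in>{1..b} \<times> {1..b}. \<zero>\<^bsub>A\<^esub>),
     add = (\<lambda>S T. \<lambda>(i, j)\<in>{1..b} \<times> {1..b}. S (i, j) \<oplus>\<^bsub>A\<^esub> T (i, j)),
     smult = (\<lambda>c S. \<lambda>(i, j)\<in>{1..b} \<times> {1..b}. c \<odot>\<^bsub>A\<^esub> S (i, j)),
     star = (\<lambda>S. \<lambda>(i, j)\<in>{1..b} \<times> {1..b}. star A (S (j, i)))\<rparr>"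

definition mat_unit :: "nat \<Rightarrow> nat \<Rightarrow> nat \<Rightarrow> nat \<times> nat \<Rightarrow> complex" where
  "mat_unit b i j = (\<lambda>p\<in>{1..b} \<times> {1..b}. if p = (i, j) then 1 else 0)"

definition mat_transpose :: "nat \<Rightarrow> (nat \<times> nat \<Rightarrow> 'a) \<Rightarrow> nat \<times> nat \<Rightarrow> 'a" where
  "mat_transpose b S = (\<lambda>(i, j)\<in>{1..b} \<times> {1..b}. S (j, i))"

definition mat_state :: "nat \<Rightarrow> ('a \<Rightarrow> complex) \<Rightarrow> (nat \<times> nat \<Rightarrow> 'a) \<Rightarrow> complex" where
  "mat_state b \<phi> S = (1 / of_nat b) * (\<Sum>i=1..b. \<phi> (S (i, i)))"

abbreviation normalized_trace :: "nat \<Rightarrow> (nat \<times> nat \<Rightarrow> complex) \<Rightarrow> complex" where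
  "normalized_trace b \<equiv> mat_state b (\<lambda>z. z)"

definition circle_algebra :: "(complex \<Rightarrow> complex) star_algebra" where
  "circle_algebra = \<lparr>
     carrier = {f \<in> extensional (sphere 0 1). continuous_on (sphere 0 1) f},
     mult = (\<lambda>f g. \<lambda>z\<in>sphere 0 1. f z * g z),
     one = (\<lambda>z\<in>sphere 0 1. 1),
     zero = (\<lambda>z\<in>sphere 0 1. 0),
     add = (\<lambda>f g. \<lambda>z\<in>sphere 0 1. f z + g z),
     smult = (\<lambda>c f. \<lambda>z\<in>sphere 0 1. c * f z),
     star = (\<lambda>f. \<lambda>z\<in>sphere 0 1. cnj (f z))\<rparr>"

definition circle_id :: "complex \<Rightarrow> complex" where
  "circle_id = (\<lambda>z\<in>sphere 0 1. z)"

definition haar_integral :: "(complex \<Rightarrow> complex) \<Rightarrow> complex" where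
  "haar_integral f = (1 / of_real (2 * pi)) * integral {0..2*pi} (\<lambda>t. f (cis t))"


section \<open>Unital free products and the Brown algebra\<close>

text \<open>\<open>A\<close> with the homomorphisms \<open>\<iota>1\<close>, \<open>\<iota>2\<close> is the coproduct of the
  unital C*-algebras \<open>A1\<close> and \<open>A2\<close>. Norms on \<open>A1\<close> and \<open>A2\<close> are not needed, because
  *-homomorphisms between C*-algebras are contractive.

  The test algebras \<open>B\<close> have their carriers in the type of the elements of \<open>A\<close>. For separable
  \<open>A1\<close>, \<open>A2\<close> and nonzero \<open>A\<close> this is no restriction: only the C*-subalgebra generated by the
  two images matters, it has at most the cardinality of the continuum, and the carrier of \<open>A\<close>
  contains a copy of the complex numbers.\<close>

definition cstar_free_product ::
    "('x, 'm) star_algebra_scheme \<Rightarrow> ('y, 'n) star_algebra_scheme \<Rightarrow>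
     'a cstar_algebra \<Rightarrow> ('x \<Rightarrow> 'a) \<Rightarrow> ('y \<Rightarrow> 'a) \<Rightarrow> bool" where
  "cstar_free_product A1 A2 A \<iota>1 \<iota>2 \<longleftrightarrow>
     cstar_algebra A \<and> \<iota>1 \<in> star_hom A1 A \<and> \<iota>2 \<in> star_hom A2 A \<and>
     (\<forall>(B :: 'a cstar_algebra) f g.
        cstar_algebra B \<longrightarrow> f \<in> star_hom A1 B \<longrightarrow> g \<in> star_hom A2 B \<longrightarrow>
        (\<exists>!h. h \<in> star_hom A B \<inter> extensional (carrier A) \<and>
           (\<forall>x\<in>carrier A1. h (\<iota>1 x) = f x) \<and> (\<forall>y\<in>carrier A2. h (\<iota>2 y) = g y)))"

text \<open>\<open>\<phi>\<close> is the free product of the states \<open>\<phi>1\<close> and \<open>\<phi>2\<close>: it restricts to them and makes the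
  two factors free.\<close>

definition free_product_state ::
    "('x, 'm) star_algebra_scheme \<Rightarrow> ('x \<Rightarrow> complex) \<Rightarrow>
     ('y, 'n) star_algebra_scheme \<Rightarrow> ('y \<Rightarrow> complex) \<Rightarrow>
     'a cstar_algebra \<Rightarrow> ('x \<Rightarrow> 'a) \<Rightarrow> ('y \<Rightarrow> 'a) \<Rightarrow> ('a \<Rightarrow> complex) \<Rightarrow> bool" where
  "free_product_state A1 \<phi>1 A2 \<phi>2 A \<iota>1 \<iota>2 \<phi> \<longleftrightarrow>
     star_prob_space A \<phi> \<and>
     (\<forall>x\<in>carrier A1. \<phi> (\<iota>1 x) = \<phi>1 x) \<and> (\<forall>y\<in>carrier A2. \<phi> (\<iota>2 y) = \<phi>2 y) \<and>
     free_family A \<phi> UNIV (case_bool (\<iota>1 ` carrier A1) (\<iota>2 ` carrier A2))"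

definition corner :: "('a, 'm) star_algebra_scheme \<Rightarrow> 'a \<Rightarrow> ('a, 'm) star_algebra_scheme" where
  "corner A e = A\<lparr>carrier := {e \<otimes>\<^bsub>A\<^esub> x \<otimes>\<^bsub>A\<^esub> e |x. x \<in> carrier A}, one := e\<rparr>"

text \<open>Below \<open>\<iota>\<close> is the embedding of the complex \<open>b\<close> by \<open>b\<close> matrices into their free product \<open>A\<close>
  with the continuous functions on the circle.\<close>

definition brown_algebra ::
    "nat \<Rightarrow> 'a cstar_algebra \<Rightarrow> ((nat \<times> nat \<Rightarrow> complex) \<Rightarrow> 'a) \<Rightarrow> 'a cstar_algebra" where
  "brown_algebra b A \<iota> = corner A (\<iota> (mat_unit b 1 1))"

definition brown_state :: "nat \<Rightarrow> ('a \<Rightarrow> complex) \<Rightarrow> 'a \<Rightarrow> complex" where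
  "brown_state b \<phi> x = of_nat b * \<phi> x"

text \<open>The identification of \<open>A\<close> with the matrices over the Brown algebra.\<close>

definition brown_matrix ::
    "nat \<Rightarrow> 'a cstar_algebra \<Rightarrow> ((nat \<times> nat \<Rightarrow> complex) \<Rightarrow> 'a) \<Rightarrow> 'a \<Rightarrow> nat \<times> nat \<Rightarrow> 'a" where
  "brown_matrix b A \<iota> x =
     (\<lambda>(i, j)\<in>{1..b} \<times> {1..b}. \<iota> (mat_unit b 1 i) \<otimes>\<^bsub>A\<^esub> x \<otimes>\<^bsub>A\<^esub> \<iota> (mat_unit b j 1))"

end

theory Submission
  imports Defs
begin

text \<open>
  Identify the algebra with the matrices over the Brown algebra. The matrix \<open>v\<^sup>t\<close> then corresponds to
  the sum of all \<open>e\<^sub>i\<^sub>j v e\<^sub>i\<^sub>j\<close> (\<open>transpose_brown_matrix\<close>), and because of traciality the state on the matrices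
  corresponds to the given state on the free product. The statement thus concerns the single element
  \<open>\<Sum> e\<^sub>i\<^sub>j v e\<^sub>i\<^sub>j\<close> of the free product.

  The tensor \<open>\<Sum> e\<^sub>i\<^sub>j \<otimes> e\<^sub>i\<^sub>j\<close> can be written in any orthonormal basis of the matrices together with the
  complex conjugate basis. Matrix units are one choice. Another one consists of the Weyl matrices
  \<open>W\<^sub>k\<close>, divided by the square root of \<open>b\<close>. They are \<open>b\<^sup>2\<close> pairwise orthogonal unitaries. Comparing the two
  choices gives

    \<open>\<Sum> e\<^sub>i\<^sub>j v e\<^sub>i\<^sub>j = (1 / b) \<Sum>\<^sub>k u\<^sub>k\<close>   with   \<open>u\<^sub>k = W\<^sub>k v cnj W\<^sub>k\<close>,

  where \<open>cnj\<close> is taken entrywise (\<open>sum_of_weyl_twists\<close>), and the \<open>u\<^sub>k\<close> are unitary.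

  It remains to see that the \<open>u\<^sub>k\<close> are *-free Haar unitaries. A reduced word in the \<open>u\<^sub>k\<close> and their adjoints
  is a product of matrices and of letters \<open>v\<close> and \<open>v\<^sup>*\<close>. A matrix between letters of different kind is
  \<open>cnj W\<^sub>k (cnj W\<^sub>l)\<^sup>*\<close> or \<open>W\<^sub>k\<^sup>* W\<^sub>l\<close> with \<open>k \<noteq> l\<close>, hence traceless. A matrix between letters of the same kind
  splits into a traceless one and a scalar, and the scalar only merges powers of \<open>v\<close> of the same sign.
  By freeness, the state vanishes on each of the resulting products
  (\<open>twisted_Haar_free_unitaries\<close>).

  For unitaries in general, vanishing of the state on all nonempty reduced words is equivalent to
  being *-free Haar unitaries (\<open>free_haar_imp_free_unitaries\<close>, \<open>free_unitaries_imp_free_haar\<close>). It also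
  determines the moments of all words, because a word that is not reduced can be shortened. Hence the
  *-distribution of a multiple of the sum does not depend on the space or on the choice of the unitaries
  (\<open>free_unitaries_same_distribution_of_sum\<close>), which covers arbitrary *-free Haar unitaries.
\<close>


section \<open>Arithmetic in *-algebras\<close>

text \<open>The scalars of a module form a ring as well, so in a locale that extends the module locale the
  unqualified names of the ring laws denote the laws of the complex numbers. In this locale they
  denote the laws of the algebra.\<close>

locale star_ring = ring A for A :: "('a, 'm) star_algebra_scheme" (structure) +
  assumes star_algebra_A: "star_algebra A"

lemma star_ring_iff: "star_ring A \<longleftrightarrow> star_algebra A"
  by (auto simp: star_ring_def star_ring_axioms_def star_algebra_def)

context star_ring
begin

lemma module_A: "Module.module complex_algebra A"
  using star_algebra_A by (simp add: star_algebra_def)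

lemmas smult_mult_left = star_algebra.smult_mult_left[OF star_algebra_A]
  and smult_mult_right = star_algebra.smult_mult_right[OF star_algebra_A]
  and star_closed [simp] = star_algebra.star_closed[OF star_algebra_A]
  and star_star = star_algebra.star_star[OF star_algebra_A]
  and star_add = star_algebra.star_add[OF star_algebra_A]
  and star_mult = star_algebra.star_mult[OF star_algebra_A]
  and star_smult = star_algebra.star_smult[OF star_algebra_A]

lemma smult_in_carrier [simp]: "x \<in> carrier A \<Longrightarrow> c \<odot> x \<in> carrier A"
  using module.smult_closed[OF module_A] by (simp add: complex_algebra_def)

lemma unit_smult [simp]: "x \<in> carrier A \<Longrightarrow> 1 \<odot> x = x"
  using module.smult_one[OF module_A] by (simp add: complex_algebra_def)

lemma zero_smult [simp]: "x \<in> carrier A \<Longrightarrow> 0 \<odot> x = \<zero>"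
  using module.smult_l_null[OF module_A] by (simp add: complex_algebra_def)

lemma smult_zero_right [simp]: "c \<odot> \<zero> = \<zero>"
  using module.smult_r_null[OF module_A] by (simp add: complex_algebra_def)

lemma smult_smult: "x \<in> carrier A \<Longrightarrow> c \<odot> (d \<odot> x) = (c * d) \<odot> x"
  using module.smult_assoc1[OF module_A, of c d x] by (simp add: complex_algebra_def)

lemma smult_add_left: "x \<in> carrier A \<Longrightarrow> (c + d) \<odot> x = c \<odot> x \<oplus> d \<odot> x"
  using module.smult_l_distr[OF module_A, of c d x] by (simp add: complex_algebra_def)

lemma smult_add_right:
  "x \<in> carrier A \<Longrightarrow> y \<in> carrier A \<Longrightarrow> c \<odot> (x \<oplus> y) = c \<odot> x \<oplus> c \<odot> y"
  using module.smult_r_distr[OF module_A, of c x y] by (simp add: complex_algebra_def)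

lemma smult_finsum:
  "finite F \<Longrightarrow> f \<in> F \<rightarrow> carrier A \<Longrightarrow> c \<odot> (\<Oplus>i\<in>F. f i) = (\<Oplus>i\<in>F. c \<odot> f i)"
  by (induction F rule: finite_induct) (auto simp: smult_add_right Pi_def)

lemma sum_smult:
  "finite F \<Longrightarrow> x \<in> carrier A \<Longrightarrow> (\<Sum>i\<in>F. c i) \<odot> x = (\<Oplus>i\<in>F. c i \<odot> x)"
  by (induction F rule: finite_induct) (auto simp: smult_add_left)

lemma finsum_exchange:
  assumes "finite F" "finite G" "\<And>i j. i \<in> F \<Longrightarrow> j \<in> G \<Longrightarrow> f i j \<in> carrier A"
  shows "(\<Oplus>i\<in>F. \<Oplus>j\<in>G. f i j) = (\<Oplus>j\<in>G. \<Oplus>i\<in>F. f i j)"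
  using assms
proof (induction F rule: finite_induct)
  case (insert x F)
  have c: "(\<lambda>i. \<Oplus>j\<in>G. f i j) \<in> F \<rightarrow> carrier A" "(\<Oplus>j\<in>G. f x j) \<in> carrier A"
      "f x \<in> G \<rightarrow> carrier A" "(\<lambda>j. \<Oplus>i\<in>F. f i j) \<in> G \<rightarrow> carrier A"
    using insert.prems by (auto intro!: finsum_closed)
  have "(\<Oplus>i\<in>insert x F. \<Oplus>j\<in>G. f i j) = (\<Oplus>j\<in>G. f x j) \<oplus> (\<Oplus>i\<in>F. \<Oplus>j\<in>G. f i j)"
    using insert.hyps c by (intro finsum_insert)
  also have "(\<Oplus>i\<in>F. \<Oplus>j\<in>G. f i j) = (\<Oplus>j\<in>G. \<Oplus>i\<in>F. f i j)"
    using insert by blast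
  also have "(\<Oplus>j\<in>G. f x j) \<oplus> \<dots> = (\<Oplus>j\<in>G. f x j \<oplus> (\<Oplus>i\<in>F. f i j))"
    using c by (intro finsum_addf[symmetric])
  also have "\<dots> = (\<Oplus>j\<in>G. \<Oplus>i\<in>insert x F. f i j)"
    using insert c by (intro finsum_cong' refl finsum_insert[symmetric]) auto
  finally show ?case .
qed simp

lemma star_zero [simp]: "star A \<zero> = \<zero>"
  using star_smult[of \<zero> 0] star_closed[of \<zero>] by simp

lemma star_one [simp]: "star A \<one> = \<one>"
proof -
  have "star A (star A \<one> \<otimes> \<one>) = star A \<one> \<otimes> star A (star A \<one>)"
    by (intro star_mult) auto
  thus ?thesis
    by (simp add: star_star star_closed)
qed

lemma star_finsum:
  "finite F \<Longrightarrow> f \<in> F \<rightarrow> carrier A \<Longrightarrow> star A (\<Oplus>i\<in>F. f i) = (\<Oplus>i\<in>F. star A (f i))"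
  by (induction F rule: finite_induct) (auto simp: star_add star_closed Pi_def)

lemma eval_letter_closed [simp]: "x \<in> carrier A \<Longrightarrow> eval_letter A x l \<in> carrier A"
  by (cases l) auto

lemma eval_word_Nil [simp]: "eval_word A a [] = \<one>"
  by (simp add: eval_word_def)

lemma eval_word_Cons [simp]: "eval_word A a (l # w) = eval_letter A a l \<otimes> eval_word A a w"
  by (simp add: eval_word_def)

lemma eval_word_closed [simp]: "a \<in> carrier A \<Longrightarrow> eval_word A a w \<in> carrier A"
  by (induction w) auto

end


section \<open>Integer powers of unitaries\<close>

definition unitary :: "('a, 'm) star_algebra_scheme \<Rightarrow> 'a \<Rightarrow> bool" where
  "unitary A u \<longleftrightarrow> u \<in> carrier A \<and> star A u \<otimes>\<^bsub>A\<^esub> u = \<one>\<^bsub>A\<^esub> \<and> u \<otimes>\<^bsub>A\<^esub> star A u = \<one>\<^bsub>A\<^esub>"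

lemma haar_unitary_altdef:
  "haar_unitary A \<phi> u \<longleftrightarrow> unitary A u \<and> (\<forall>k::int. k \<noteq> 0 \<longrightarrow> \<phi> (u [^]\<^bsub>A\<^esub> k) = 0)"
  by (auto simp: haar_unitary_def unitary_def)

fun letter_sign :: "star_letter \<Rightarrow> int" where
  "letter_sign X = 1"
| "letter_sign X_star = -1"

context star_ring
begin

lemma unitary_Units: "unitary A u \<Longrightarrow> u \<in> Units A"
  unfolding unitary_def Units_def using star_closed by blast

lemma unitary_inv: "unitary A u \<Longrightarrow> inv u = star A u"
  unfolding unitary_def using inv_char star_closed by blast

text \<open>This carries the laws of integer powers over from the group of units, where they hold for
  all elements.\<close>

lemma int_pow_units_of:
  assumes "u \<in> Units A"
  shows "u [^]\<^bsub>units_of A\<^esub> (k::int) = u [^] k"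
proof -
  have n: "u [^]\<^bsub>units_of A\<^esub> (n::nat) = u [^] n" for n
    by (induction n) (auto simp: units_of_def nat_pow_def)
  have U: "u [^] (n::nat) \<in> Units A" for n
    using assms by (induction n) auto
  show ?thesis
    by (simp only: int_pow_def2 n units_of_inv[OF U])
qed

lemma unitary_pow_closed [simp]: "unitary A u \<Longrightarrow> u [^] (k::int) \<in> carrier A"
proof -
  assume "unitary A u"
  hence u: "u \<in> Units A" by (rule unitary_Units)
  interpret G: group "units_of A" by (rule units_group)
  have "u [^]\<^bsub>units_of A\<^esub> k \<in> carrier (units_of A)"
    using u by (intro G.int_pow_closed) (simp add: units_of_def)
  thus ?thesis
    using u by (simp add: int_pow_units_of units_of_carrier Units_closed)
qed

lemma unitary_pow_add:
  assumes "unitary A u"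
  shows "u [^] (k + m :: int) = u [^] k \<otimes> u [^] m"
proof -
  have u: "u \<in> Units A" using assms by (rule unitary_Units)
  interpret G: group "units_of A" by (rule units_group)
  have "u [^]\<^bsub>units_of A\<^esub> (k + m) = u [^]\<^bsub>units_of A\<^esub> k \<otimes>\<^bsub>units_of A\<^esub> u [^]\<^bsub>units_of A\<^esub> m"
    using u by (intro G.int_pow_mult) (simp add: units_of_def)
  thus ?thesis
    using u by (simp add: int_pow_units_of units_of_mult)
qed

lemma unitary_pow_1: "unitary A u \<Longrightarrow> u [^] (1::int) = u"
  unfolding int_pow_def2[of _ _ 1] by (simp add: unitary_def)

lemma unitary_pow_uminus_1: "unitary A u \<Longrightarrow> u [^] (-1::int) = star A u"
  unfolding int_pow_def2[of _ _ "-1"] using unitary_inv by (simp add: unitary_def)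

lemma eval_letter_unitary: "unitary A u \<Longrightarrow> eval_letter A u l = u [^] letter_sign l"
  by (cases l) (auto simp: unitary_pow_1 unitary_pow_uminus_1)

lemma star_unitary_pow:
  assumes "unitary A u"
  shows "star A (u [^] (k::int)) = u [^] (- k)"
proof -
  have u: "u \<in> carrier A" and su: "star A u \<in> carrier A"
    using assms star_closed by (auto simp: unitary_def)
  have step: "star A (u [^] m) = u [^] (- m) \<Longrightarrow> star A (u [^] (m + d)) = u [^] (- (m + d))"
    if "d \<in> {1, -1}" for m d :: int
  proof -
    assume IH: "star A (u [^] m) = u [^] (- m)"
    have d: "star A (u [^] d) = u [^] (- d)"
      using that u by (auto simp: unitary_pow_1[OF assms] unitary_pow_uminus_1[OF assms] star_star)
    have "star A (u [^] (m + d)) = star A (u [^] d) \<otimes> star A (u [^] m)"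
      using assms by (simp add: unitary_pow_add star_mult)
    also have "\<dots> = u [^] (- d + - m)"
      using assms by (simp only: IH d unitary_pow_add)
    finally show ?thesis by (simp add: add.commute)
  qed
  show ?thesis
  proof (induction k rule: int_induct[where k = 0])
    case base thus ?case by simp
  next
    case (step1 i) thus ?case using step[of 1 i] by simp
  next
    case (step2 i) thus ?case using step[of "-1" i] by simp
  qed
qed

end


section \<open>Families of unitaries that behave like the generators of a free group\<close>

definition word_prod ::
    "('a, 'm) star_algebra_scheme \<Rightarrow> ('i \<Rightarrow> 'a) \<Rightarrow> ('i \<times> star_letter) list \<Rightarrow> 'a" where
  "word_prod A u w = foldr (\<lambda>(i, l) y. eval_letter A (u i) l \<otimes>\<^bsub>A\<^esub> y) w \<one>\<^bsub>A\<^esub>"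

definition reduced :: "('i \<times> star_letter) list \<Rightarrow> bool" where
  "reduced w \<longleftrightarrow> successively (\<lambda>(i, l) (j, m). i = j \<longrightarrow> l = m) w"

text \<open>This says that the unitaries generate a free group on which the functional is the canonical trace
  of the group algebra. It is equivalent to being *-free Haar unitaries, and it has the advantage
  that it can be checked, and used, one word at a time.\<close>

definition free_unitaries ::
    "('a, 'm) star_algebra_scheme \<Rightarrow> ('a \<Rightarrow> complex) \<Rightarrow> 'i set \<Rightarrow> ('i \<Rightarrow> 'a) \<Rightarrow> bool" where
  "free_unitaries A \<phi> I u \<longleftrightarrow>
     (\<forall>i\<in>I. unitary A (u i)) \<and>
     (\<forall>w. w \<noteq> [] \<longrightarrow> fst ` set w \<subseteq> I \<longrightarrow> reduced w \<longrightarrow> \<phi> (word_prod A u w) = 0)"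

text \<open>Products of powers are the normal form of a reduced word that fits the definition of freeness:
  there, neighbouring factors must come from different subalgebras, whereas a reduced word may
  repeat a letter.\<close>

definition block_prod ::
    "('a, 'm) star_algebra_scheme \<Rightarrow> ('i \<Rightarrow> 'a) \<Rightarrow> ('i \<times> int) list \<Rightarrow> 'a" where
  "block_prod A u ks = foldr (\<lambda>(i, k) y. u i [^]\<^bsub>A\<^esub> k \<otimes>\<^bsub>A\<^esub> y) ks \<one>\<^bsub>A\<^esub>"

lemma reduced_Nil [simp]: "reduced []"
  by (simp add: reduced_def)

lemma reduced_Cons_Cons [simp]:
  "reduced ((i, l) # (j, m) # w) \<longleftrightarrow> (i = j \<longrightarrow> l = m) \<and> reduced ((j, m) # w)"
  by (simp add: reduced_def)

text \<open>A cancelling pair is what allows an induction on the length of a word.\<close>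

lemma not_reduced_cancel:
  "\<not> reduced w \<Longrightarrow> \<exists>p i l m s. w = p @ (i, l) # (i, m) # s \<and> l \<noteq> m"
proof (induction w)
  case (Cons a w)
  show ?case
  proof (cases "reduced w")
    case False
    with Cons obtain p i l m s where "w = p @ (i, l) # (i, m) # s" "l \<noteq> m" by blast
    thus ?thesis by (intro exI[of _ "a # p"]) auto
  next
    case True
    with Cons(2) obtain i l m s where "a = (i, l)" "w = (i, m) # s" "l \<noteq> m"
      by (cases a; cases w) (auto simp: reduced_def)
    thus ?thesis by (intro exI[of _ "[]"]) auto
  qed
qed simp

context star_ring
begin

lemma word_prod_Nil [simp]: "word_prod A u [] = \<one>"
  by (simp add: word_prod_def)

lemma word_prod_Cons [simp]:
  "word_prod A u ((i, l) # w) = eval_letter A (u i) l \<otimes> word_prod A u w"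
  by (simp add: word_prod_def)

lemma word_prod_closed [simp]:
  "u \<in> I \<rightarrow> carrier A \<Longrightarrow> fst ` set w \<subseteq> I \<Longrightarrow> word_prod A u w \<in> carrier A"
  by (induction w) (auto simp: Pi_def)

lemma word_prod_append:
  assumes "u \<in> I \<rightarrow> carrier A" "fst ` set v \<subseteq> I" "fst ` set w \<subseteq> I"
  shows "word_prod A u (v @ w) = word_prod A u v \<otimes> word_prod A u w"
  using assms(2)
proof (induction v)
  case (Cons a v)
  moreover have "word_prod A u v \<in> carrier A" "word_prod A u w \<in> carrier A"
    using Cons assms by (auto intro!: word_prod_closed[where I = I])
  ultimately show ?case
    using assms by (cases a) (auto simp: m_assoc Pi_def)
qed (use assms in \<open>auto intro!: word_prod_closed[where I = I]\<close>)

lemma block_prod_Nil [simp]: "block_prod A u [] = \<one>"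
  by (simp add: block_prod_def)

lemma block_prod_Cons [simp]: "block_prod A u ((i, k) # ks) = u i [^] k \<otimes> block_prod A u ks"
  by (simp add: block_prod_def)

lemma block_prod_closed [simp]:
  "\<forall>i\<in>I. unitary A (u i) \<Longrightarrow> fst ` set ks \<subseteq> I \<Longrightarrow> block_prod A u ks \<in> carrier A"
  by (induction ks) auto

lemma block_prod_append:
  assumes "\<forall>i\<in>I. unitary A (u i)" "fst ` set ks \<subseteq> I" "fst ` set ls \<subseteq> I"
  shows "block_prod A u (ks @ ls) = block_prod A u ks \<otimes> block_prod A u ls"
  using assms(2)
proof (induction ks)
  case (Cons a ks)
  moreover have "block_prod A u ks \<in> carrier A" "block_prod A u ls \<in> carrier A"
    using Cons assms by (auto intro!: block_prod_closed[where I = I])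
  ultimately show ?case
    using assms by (cases a) (auto simp: m_assoc)
qed (use assms in \<open>auto intro!: block_prod_closed[where I = I]\<close>)

text \<open>Merging runs of equal letters never produces the exponent 0, because in a reduced word all letters
  of a run with the same index have the same sign. For this reason the induction also records the
  sign of the leading exponent.\<close>

lemma reduced_word_as_blocks:
  assumes u: "\<forall>i\<in>I. unitary A (u i)"
  assumes "w \<noteq> []" "fst ` set w \<subseteq> I" "reduced w"
  shows "\<exists>ks. ks \<noteq> [] \<and> distinct_adj (map fst ks) \<and> fst ` set ks \<subseteq> I \<and> 0 \<notin> snd ` set ks \<and>
           fst (hd ks) = fst (hd w) \<and> sgn (snd (hd ks)) = letter_sign (snd (hd w)) \<and>
           word_prod A u w = block_prod A u ks"
  using assms(2-)
proof (induction w)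
  case (Cons a w)
  obtain i l where a: "a = (i, l)" by (cases a)
  have i: "i \<in> I" "unitary A (u i)" using Cons a u by auto
  have s: "letter_sign l \<noteq> 0" "sgn (letter_sign l) = letter_sign l" by (cases l; simp)+
  show ?case
  proof (cases w)
    case Nil
    thus ?thesis
      using i s a by (intro exI[of _ "[(i, letter_sign l)]"]) (auto simp: eval_letter_unitary)
  next
    case (Cons c w')
    obtain j m where c: "c = (j, m)" by (cases c)
    have "reduced w"
      using \<open>reduced (a # w)\<close> Cons a c by simp
    then obtain ks where ks: "ks \<noteq> []" "distinct_adj (map fst ks)" "fst ` set ks \<subseteq> I"
        "0 \<notin> snd ` set ks" "fst (hd ks) = j" "sgn (snd (hd ks)) = letter_sign m"
        "word_prod A u w = block_prod A u ks"
      using Cons.IH Cons.prems Cons c by auto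
    obtain k ks' where ks': "ks = (j, k) # ks'"
      using ks by (cases ks) auto
    have k: "k \<noteq> 0" "sgn k = letter_sign m" using ks ks' by auto
    show ?thesis
    proof (cases "i = j")
      case False
      thus ?thesis
        using i s a ks ks'
        by (intro exI[of _ "(i, letter_sign l) # ks"]) (auto simp: eval_letter_unitary)
    next
      case True
      hence lm: "l = m" using \<open>reduced (a # w)\<close> Cons a c by simp
      have "letter_sign l + k \<noteq> 0" "sgn (letter_sign l + k) = letter_sign l"
        using k lm by (cases m; auto simp: sgn_if split: if_splits)+
      moreover have "block_prod A u ks' \<in> carrier A"
        using ks ks' u by (intro block_prod_closed[where I = I]) auto
      ultimately show ?thesis
        using i s a ks ks' True Cons c
        by (intro exI[of _ "(i, letter_sign l + k) # ks'"])
           (auto simp: eval_letter_unitary unitary_pow_add m_assoc distinct_adj_Cons)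
    qed
  qed
qed simp

text \<open>A power expands to a run of a single letter, and the runs of neighbouring blocks have different
  indices, so nothing cancels at the seams.\<close>

lemma blocks_as_reduced_word:
  assumes u: "\<forall>i\<in>I. unitary A (u i)"
  assumes "distinct_adj (map fst ks)" "fst ` set ks \<subseteq> I" "0 \<notin> snd ` set ks"
  shows "\<exists>w. fst ` set w \<subseteq> I \<and> reduced w \<and> (ks \<noteq> [] \<longrightarrow> w \<noteq> [] \<and> fst (hd w) = fst (hd ks)) \<and>
           (ks = [] \<longrightarrow> w = []) \<and> word_prod A u w = block_prod A u ks"
  using assms(2-)
proof (induction ks)
  case (Cons a ks)
  obtain i k where a: "a = (i, k)" by (cases a)
  have i: "i \<in> I" "unitary A (u i)" and k: "k \<noteq> 0" using Cons a u by auto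
  have "distinct_adj (map fst ks)"
    using Cons.prems(1) by (auto dest: distinct_adj_ConsD)
  then obtain w where w: "fst ` set w \<subseteq> I" "reduced w"
      "ks \<noteq> [] \<Longrightarrow> w \<noteq> [] \<and> fst (hd w) = fst (hd ks)" "ks = [] \<Longrightarrow> w = []"
      "word_prod A u w = block_prod A u ks"
    using Cons by auto
  define l where "l = (if k > 0 then X else X_star)"
  have rep: "word_prod A u (replicate n (i, l)) = u i [^] (int n * letter_sign l)" for n
    by (induction n)
       (auto simp: eval_letter_unitary i unitary_pow_add[symmetric] algebra_simps)
  define n where "n = nat \<bar>k\<bar>"
  have n: "n > 0" "int n * letter_sign l = k" using k by (auto simp: n_def l_def)
  have uc: "u \<in> I \<rightarrow> carrier A" using u by (auto simp: unitary_def)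
  let ?w = "replicate n (i, l) @ w"
  have *: "reduced (replicate n (i, l))" for n
  proof (induction n)
    case (Suc n)
    thus ?case by (cases n) (auto simp: reduced_def)
  qed simp
  have "w \<noteq> [] \<Longrightarrow> fst (hd w) \<noteq> i"
    using w(3,4) Cons.prems(1) a by (cases ks) auto
  hence "reduced ?w"
    using *[of n] w(2) n unfolding reduced_def successively_append_iff
    by (auto split: prod.splits) (metis fst_conv last_in_set in_set_replicate)
  moreover have "word_prod A u ?w = block_prod A u (a # ks)"
    using w i uc by (subst word_prod_append[OF uc]) (auto simp: a rep n)
  moreover have "?w \<noteq> []" "fst (hd ?w) = i" using n by (auto simp: hd_append)
  ultimately show ?case
    using w i a by (intro exI[of _ ?w]) auto
qed auto

end

section \<open>Freeness in terms of reduced words\<close>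

locale star_state = star_ring A for A :: "('a, 'm) star_algebra_scheme" (structure) +
  fixes \<phi> :: "'a \<Rightarrow> complex"
  assumes star_prob_space_A: "star_prob_space A \<phi>"

lemma star_state_iff: "star_state A \<phi> \<longleftrightarrow> star_prob_space A \<phi>"
  by (auto simp: star_state_def star_state_axioms_def star_ring_iff star_prob_space_def)

context star_state
begin

lemma state_add: "x \<in> carrier A \<Longrightarrow> y \<in> carrier A \<Longrightarrow> \<phi> (x \<oplus> y) = \<phi> x + \<phi> y"
  using star_prob_space_A by (simp add: star_prob_space_def)

lemma state_smult: "x \<in> carrier A \<Longrightarrow> \<phi> (c \<odot> x) = c * \<phi> x"
  using star_prob_space_A by (simp add: star_prob_space_def)

lemma state_one [simp]: "\<phi> \<one> = 1"
  using star_prob_space_A by (simp add: star_prob_space_def)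

lemma state_zero [simp]: "\<phi> \<zero> = 0"
  using state_smult[of \<zero> 0] by simp

lemma state_finsum:
  "finite F \<Longrightarrow> f \<in> F \<rightarrow> carrier A \<Longrightarrow> \<phi> (\<Oplus>i\<in>F. f i) = (\<Sum>i\<in>F. \<phi> (f i))"
  by (induction F rule: finite_induct) (auto simp: state_add Pi_def)

end

text \<open>Linear combinations are built up one term at a time, so that statements about multilinear
  expansions become inductions, without any coefficient families.\<close>

inductive_set lin_span :: "('a, 'm) star_algebra_scheme \<Rightarrow> 'a set \<Rightarrow> 'a set"
  for A (structure) and S where
    zero: "\<zero> \<in> lin_span A S"
  | step: "s \<in> S \<Longrightarrow> x \<in> lin_span A S \<Longrightarrow> c \<odot> s \<oplus> x \<in> lin_span A S"

context star_ring
begin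

lemma lin_span_closed: "x \<in> lin_span A S \<Longrightarrow> S \<subseteq> carrier A \<Longrightarrow> x \<in> carrier A"
  by (induction rule: lin_span.induct) auto

lemma lin_span_superset: "s \<in> S \<Longrightarrow> S \<subseteq> carrier A \<Longrightarrow> s \<in> lin_span A S"
  using lin_span.step[of s S "\<zero>" A 1] lin_span.zero[of A S] by auto

lemma lin_span_add:
  assumes "x \<in> lin_span A S" "y \<in> lin_span A S" "S \<subseteq> carrier A"
  shows "x \<oplus> y \<in> lin_span A S"
  using assms(1)
proof (induction rule: lin_span.induct)
  case zero
  thus ?case using assms lin_span_closed by auto
next
  case (step s x c)
  hence "c \<odot> s \<oplus> x \<oplus> y = c \<odot> s \<oplus> (x \<oplus> y)"
    using assms lin_span_closed by (intro a_assoc) auto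
  thus ?case using step lin_span.step by metis
qed

lemma lin_span_smult:
  assumes "x \<in> lin_span A S" "S \<subseteq> carrier A"
  shows "d \<odot> x \<in> lin_span A S"
  using assms(1)
proof (induction rule: lin_span.induct)
  case (step s x c)
  hence "d \<odot> (c \<odot> s \<oplus> x) = (d * c) \<odot> s \<oplus> d \<odot> x"
    using assms lin_span_closed by (subst smult_add_right) (auto simp: smult_smult)
  thus ?case using step lin_span.step by metis
qed (auto intro: lin_span.zero)

text \<open>The function may transform the scalars, because the adjoint conjugates them.\<close>

lemma lin_span_image:
  assumes "x \<in> lin_span A S" "S \<subseteq> carrier A"
    and "f \<zero> = \<zero>" "\<And>x y. x \<in> carrier A \<Longrightarrow> y \<in> carrier A \<Longrightarrow> f (x \<oplus> y) = f x \<oplus> f y"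
    and "\<And>c x. x \<in> carrier A \<Longrightarrow> f (c \<odot> x) = g c \<odot> f x"
    and "\<And>s. s \<in> S \<Longrightarrow> f s \<in> lin_span A T" "T \<subseteq> carrier A"
  shows "f x \<in> lin_span A T"
  using assms(1)
proof (induction rule: lin_span.induct)
  case zero
  thus ?case by (simp add: assms lin_span.zero)
next
  case (step s x c)
  hence "s \<in> carrier A" "x \<in> carrier A"
    using assms(2) lin_span_closed by auto
  hence "f (c \<odot> s \<oplus> x) = g c \<odot> f s \<oplus> f x"
    by (simp add: assms(4,5))
  thus ?case using step assms by (auto intro!: lin_span_add lin_span_smult)
qed

lemma lin_span_mult:
  assumes "x \<in> lin_span A S" "y \<in> lin_span A S" "S \<subseteq> carrier A"
    and "\<And>s t. s \<in> S \<Longrightarrow> t \<in> S \<Longrightarrow> s \<otimes> t \<in> S"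
  shows "x \<otimes> y \<in> lin_span A S"
proof (rule lin_span_image[OF assms(1,3), where f = "\<lambda>x. x \<otimes> y" and g = "\<lambda>c. c"])
  fix s assume s: "s \<in> S"
  show "s \<otimes> y \<in> lin_span A S"
    using assms s
    by (intro lin_span_image[OF assms(2,3), where f = "\<lambda>y. s \<otimes> y" and g = "\<lambda>c. c"])
       (auto simp: r_distr smult_mult_right intro!: lin_span_superset)
qed (use assms lin_span_closed in \<open>auto simp: l_distr smult_mult_left\<close>)

text \<open>The powers of a unitary are closed under products and adjoints, so their span is already a *-algebra.\<close>

lemma star_gen_unitary:
  assumes u: "unitary A u" and x: "x \<in> star_gen A {u}"
  shows "x \<in> lin_span A (range (\<lambda>k::int. u [^] k))" (is "_ \<in> lin_span A ?P")
proof -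
  have P: "?P \<subseteq> carrier A" using u by auto
  show ?thesis
    using x
  proof (induction rule: star_gen.induct)
    case (incl x)
    hence "x = u [^] (1::int)" using u by (simp add: unitary_pow_1)
    thus ?case using P by (auto intro: lin_span_superset)
  next
    case one
    show ?case using lin_span_superset[OF rangeI P, of 0] by simp
  next
    case (mult x y)
    thus ?case
      using u by (intro lin_span_mult P) (auto simp: unitary_pow_add[symmetric])
  next
    case (star x)
    have "star A s \<in> lin_span A ?P" if s: "s \<in> ?P" for s
    proof -
      obtain k where "s = u [^] (k::int)" using s by blast
      hence "star A s = u [^] (- k)" by (simp only: star_unitary_pow[OF u])
      thus ?thesis using lin_span_superset[OF rangeI P] by metis
    qed
    thus ?case
      by (intro lin_span_image[OF star.IH P, where f = "star A" and g = cnj])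
        (simp_all add: star_add star_smult P)
  qed (use P in \<open>simp_all add: lin_span_add lin_span_smult\<close>)
qed

end

context star_state
begin

lemma lin_span_split_constant:
  assumes u: "unitary A u"
    and "x \<in> lin_span A (range (\<lambda>k::int. u [^] k))"
  shows "\<exists>c. \<exists>y\<in>lin_span A ((\<lambda>k::int. u [^] k) ` (- {0})). x = c \<odot> \<one> \<oplus> y"
  using assms(2)
proof (induction rule: lin_span.induct)
  case zero
  show ?case by (rule exI[of _ 0], rule bexI[of _ \<zero>]) (auto intro: lin_span.zero)
next
  case (step s x c)
  let ?S = "(\<lambda>k::int. u [^] k) ` (- {0})"
  obtain k where k: "s = u [^] (k::int)" using step by auto
  obtain d y where y: "y \<in> lin_span A ?S" "x = d \<odot> \<one> \<oplus> y" using step by auto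
  have S: "?S \<subseteq> carrier A" using u by auto
  have yc: "y \<in> carrier A" using lin_span_closed[OF y(1) S] .
  show ?case
  proof (cases "k = 0")
    case True
    hence "c \<odot> s \<oplus> x = (c + d) \<odot> \<one> \<oplus> y"
      using k y yc by (simp add: smult_add_left a_assoc)
    thus ?thesis using y by blast
  next
    case False
    have "c \<odot> s \<oplus> x = d \<odot> \<one> \<oplus> (c \<odot> s \<oplus> y)"
      using k y yc u by (simp add: a_lcomm)
    moreover have "c \<odot> s \<oplus> y \<in> lin_span A ?S"
      using y k False by (intro lin_span.step) auto
    ultimately show ?thesis by blast
  qed
qed

text \<open>The functional picks out the constant coefficient of a Laurent polynomial in a Haar unitary.
  Therefore the centred elements are exactly those without constant term.\<close>

lemma centred_star_gen_Haar:
  assumes "haar_unitary A \<phi> u" "x \<in> star_gen A {u}" "\<phi> x = 0"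
  shows "x \<in> lin_span A ((\<lambda>k::int. u [^] k) ` (- {0}))"
proof -
  let ?S = "(\<lambda>k::int. u [^] k) ` (- {0})"
  have u: "unitary A u" and m: "\<And>k::int. k \<noteq> 0 \<Longrightarrow> \<phi> (u [^] k) = 0"
    using assms(1) by (auto simp: haar_unitary_altdef)
  have S: "?S \<subseteq> carrier A" using u by auto
  obtain c y where y: "y \<in> lin_span A ?S" "x = c \<odot> \<one> \<oplus> y"
    using lin_span_split_constant[OF u star_gen_unitary[OF u assms(2)]] by blast
  have yc: "y \<in> carrier A" using lin_span_closed[OF y(1) S] .
  have "\<phi> y = 0"
    using y(1)
  proof (induction rule: lin_span.induct)
    case (step s x c)
    hence "s \<in> carrier A" "x \<in> carrier A" "\<phi> s = 0"
      using lin_span_closed[OF step(2) S] S m by auto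
    thus ?case using step by (simp add: state_add state_smult)
  qed auto
  hence "c = 0" using assms(3) y yc by (simp add: state_add state_smult)
  thus ?thesis using y yc by simp
qed

lemma free_haar_imp_block_prod:
  assumes "free_haar_unitaries A \<phi> I u"
    and "ks \<noteq> []" "distinct_adj (map fst ks)" "fst ` set ks \<subseteq> I" "0 \<notin> snd ` set ks"
  shows "\<phi> (block_prod A u ks) = 0"
proof -
  have haar: "haar_unitary A \<phi> (u i)" if "i \<in> I" for i
    using assms that by (auto simp: free_haar_unitaries_def)
  have gen: "u i [^] (k::int) \<in> star_gen A {u i}" if "i \<in> I" for i k
  proof -
    have ui: "unitary A (u i)" using haar[OF that] by (simp add: haar_unitary_altdef)
    have p: "u i [^] (int n * d) \<in> star_gen A {u i}" if "d \<in> {1, -1}" for n d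
    proof (induction n)
      case 0
      thus ?case by (simp add: star_gen.one)
    next
      case (Suc n)
      have "u i [^] (int (Suc n) * d) = u i [^] d \<otimes> u i [^] (int n * d)"
        by (simp add: unitary_pow_add[OF ui, symmetric] algebra_simps)
      moreover have "u i [^] d \<in> star_gen A {u i}"
        using that ui star_gen.incl[of "u i" "{u i}" A] star_gen.star[of "u i" A "{u i}"]
        by (auto simp: unitary_pow_1 unitary_pow_uminus_1)
      ultimately show ?case using Suc by (auto intro: star_gen.mult)
    qed
    show ?thesis
      using p[of 1 "nat k"] p[of "-1" "nat (- k)"] by (cases "k \<ge> 0") auto
  qed
  let ?xs = "map (\<lambda>(i, k). (i, u i [^] (k::int))) ks"
  have "\<phi> (foldr (\<lambda>(i, x) y. x \<otimes> y) ?xs \<one>) = 0"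
  proof -
    have "?xs \<noteq> []" "distinct_adj (map fst ?xs)"
      using assms by (auto simp: comp_def case_prod_unfold)
    moreover have "\<forall>(i, x)\<in>set ?xs. i \<in> I \<and> x \<in> star_gen A {u i} \<and> \<phi> x = 0"
    proof (clarsimp, intro conjI)
      fix i k assume ik: "(i, k) \<in> set ks"
      hence "i \<in> fst ` set ks" "k \<in> snd ` set ks" by force+
      hence k: "k \<noteq> 0" and i: "i \<in> I" using assms(4,5) by auto
      show "i \<in> I" by fact
      show "\<phi> (u i [^] k) = 0" using haar[OF i] k by (simp add: haar_unitary_altdef)
      show "u i [^] k \<in> star_gen A {u i}" by (rule gen[OF i])
    qed
    ultimately show ?thesis
      using assms(1) unfolding free_haar_unitaries_def star_free_def free_family_def by blast
  qed
  also have "foldr (\<lambda>(i, x) y. x \<otimes> y) ?xs \<one> = block_prod A u ks"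
    by (induction ks) auto
  finally show ?thesis .
qed

lemma free_haar_imp_free_unitaries:
  assumes "free_haar_unitaries A \<phi> I u"
  shows "free_unitaries A \<phi> I u"
proof -
  have u: "\<forall>i\<in>I. unitary A (u i)"
    using assms by (auto simp: free_haar_unitaries_def haar_unitary_altdef)
  show ?thesis
    unfolding free_unitaries_def
  proof (intro conjI u allI impI)
    fix w :: "('b \<times> star_letter) list"
    assume "w \<noteq> []" "fst ` set w \<subseteq> I" "reduced w"
    from reduced_word_as_blocks[OF u this] show "\<phi> (word_prod A u w) = 0"
      using free_haar_imp_block_prod[OF assms] by metis
  qed
qed

lemma free_unitaries_imp_block_prod:
  assumes "free_unitaries A \<phi> I u"
    and "ks \<noteq> []" "distinct_adj (map fst ks)" "fst ` set ks \<subseteq> I" "0 \<notin> snd ` set ks"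
  shows "\<phi> (block_prod A u ks) = 0"
proof -
  have u: "\<forall>i\<in>I. unitary A (u i)" using assms(1) by (auto simp: free_unitaries_def)
  show ?thesis
    using blocks_as_reduced_word[OF u assms(3-5)] assms(1,2)
    unfolding free_unitaries_def by metis
qed

text \<open>For the freeness, every factor of an alternating product of centred elements is expanded into
  nonzero powers. This leaves a combination of products of powers with alternating indices, and each
  of them is a reduced word.\<close>

lemma free_unitaries_imp_free_haar:
  assumes "free_unitaries A \<phi> I u"
  shows "free_haar_unitaries A \<phi> I u"
proof -
  have u: "\<forall>i\<in>I. unitary A (u i)" using assms by (auto simp: free_unitaries_def)
  note block = free_unitaries_imp_block_prod[OF assms]
  have haar: "haar_unitary A \<phi> (u i)" if "i \<in> I" for i
    using block[of "[(i, _)]"] u that by (auto simp: haar_unitary_altdef)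
  \<comment> \<open>The factors are expanded from the left; \<open>ks\<close> holds the powers that were already chosen.\<close>
  have expand: "\<phi> (block_prod A u ks \<otimes> foldr (\<lambda>(i, x) y. x \<otimes> y) xs \<one>) = 0"
    if "ks @ map (\<lambda>(i, x). (i, 1)) xs \<noteq> []" "distinct_adj (map fst ks @ map fst xs)"
       "fst ` set ks \<subseteq> I" "0 \<notin> snd ` set ks"
       "\<forall>(i, x)\<in>set xs. i \<in> I \<and> x \<in> star_gen A {u i} \<and> \<phi> x = 0" for ks xs
    using that
  proof (induction xs arbitrary: ks)
    case Nil
    thus ?case using u block[of ks] by simp
  next
    case (Cons a xs)
    obtain i x where a: "a = (i, x)" by (cases a)
    let ?r = "foldr (\<lambda>(i, x) y. x \<otimes> y) xs \<one>"
    let ?S = "(\<lambda>k::int. u i [^] k) ` (- {0})"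
    have i: "i \<in> I" using Cons a by auto
    have S: "?S \<subseteq> carrier A" using u i by auto
    have span: "x \<in> lin_span A ((\<lambda>k::int. u j [^] k) ` (- {0}))" if "(j, x) \<in> set (a # xs)" for j x
      using centred_star_gen_Haar haar Cons.prems(5) that by blast
    have r: "?r \<in> carrier A"
    proof -
      have "x \<in> carrier A" if "(j, x) \<in> set xs" for j x
      proof (rule lin_span_closed)
        show "x \<in> lin_span A ((\<lambda>k::int. u j [^] k) ` (- {0}))"
          using that by (intro span) simp
        have "unitary A (u j)" using that u Cons.prems(5) by auto
        thus "(\<lambda>k::int. u j [^] k) ` (- {0}) \<subseteq> carrier A" by auto
      qed
      thus ?thesis by (induction xs) auto
    qed
    have b: "block_prod A u ks \<in> carrier A"
      using u Cons.prems by (intro block_prod_closed[where I = I])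
    have "x \<in> lin_span A ?S" using span a by auto
    hence "\<phi> (block_prod A u ks \<otimes> (x \<otimes> ?r)) = 0"
    proof (induction rule: lin_span.induct)
      case zero
      thus ?case using b r by simp
    next
      case (step s x c)
      obtain k where k: "s = u i [^] (k::int)" "k \<noteq> 0" using step by auto
      have xc: "x \<in> carrier A" "s \<in> carrier A" using lin_span_closed step S by auto
      have "block_prod A u (ks @ [(i, k)]) = block_prod A u ks \<otimes> s"
        using block_prod_append[OF u, of ks "[(i, k)]"] Cons.prems i k xc by simp
      moreover have "\<phi> (block_prod A u (ks @ [(i, k)]) \<otimes> ?r) = 0"
        using Cons.prems a i k by (intro Cons.IH) auto
      ultimately have "\<phi> (block_prod A u ks \<otimes> (s \<otimes> ?r)) = 0"
        using b r xc by (simp add: m_assoc)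
      thus ?case
        using step.IH b r xc
        by (simp add: l_distr r_distr smult_mult_left smult_mult_right state_add state_smult)
    qed
    thus ?case using a by simp
  qed
  have "\<phi> (foldr (\<lambda>(i, x) y. x \<otimes> y) xs \<one>) = 0"
    if "xs \<noteq> []" "distinct_adj (map fst xs)"
       "\<forall>(i, x)\<in>set xs. i \<in> I \<and> x \<in> star_gen A {u i} \<and> \<phi> x = 0" for xs
  proof -
    have "x \<in> carrier A" if "i \<in> I" "x \<in> star_gen A {u i}" for i x
    proof -
      have ui: "unitary A (u i)" using that u by auto
      show ?thesis
        by (rule lin_span_closed[OF star_gen_unitary[OF ui that(2)]]) (use ui in auto)
    qed
    hence "foldr (\<lambda>(i, x) y. x \<otimes> y) xs \<one> \<in> carrier A"
      using that(3) by (induction xs) auto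
    thus ?thesis using expand[of "[]" xs] that by simp
  qed
  thus ?thesis
    unfolding free_haar_unitaries_def star_free_def free_family_def
    using star_prob_space_A haar by blast
qed

lemma word_prod_cancel:
  assumes "\<forall>i\<in>I. unitary A (u i)" "fst ` set (p @ (i, l) # (i, m) # s) \<subseteq> I" "l \<noteq> m"
  shows "word_prod A u (p @ (i, l) # (i, m) # s) = word_prod A u (p @ s)"
proof -
  have uc: "u \<in> I \<rightarrow> carrier A" using assms(1) by (auto simp: unitary_def)
  have i: "i \<in> I" "unitary A (u i)" using assms by auto
  have s: "word_prod A u s \<in> carrier A"
    using assms(2) uc by (intro word_prod_closed[where I = I]) auto
  have "eval_letter A (u i) l \<otimes> eval_letter A (u i) m = \<one>"
    using i assms(3) by (cases l; cases m) (auto simp: unitary_def)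
  hence "word_prod A u ((i, l) # (i, m) # s) = word_prod A u s"
    using s i by (simp add: m_assoc[symmetric] unitary_def)
  thus ?thesis
    using assms(2) word_prod_append[OF uc, of p "(i, l) # (i, m) # s"]
      word_prod_append[OF uc, of p s] by (simp add: image_Un)
qed

end

text \<open>Cancelling neighbouring inverse letters changes neither side. It ends in the empty word, where both
  sides are 1, or in a nonempty reduced word, where both sides are 0.\<close>

lemma free_unitaries_same_word_moments:
  assumes A: "star_prob_space A \<phi>" and B: "star_prob_space B \<psi>"
    and u: "free_unitaries A \<phi> I u" and v: "free_unitaries B \<psi> I v"
    and "fst ` set w \<subseteq> I"
  shows "\<phi> (word_prod A u w) = \<psi> (word_prod B v w)"
  using assms(5)
proof (induction w rule: length_induct)
  case (1 w)
  interpret A: star_state A \<phi> using A by (simp add: star_state_iff)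
  interpret B: star_state B \<psi> using B by (simp add: star_state_iff)
  show ?case
  proof (cases "reduced w")
    case True
    thus ?thesis
      using u v "1.prems" by (cases "w = []") (auto simp: free_unitaries_def)
  next
    case False
    then obtain p i l m s where w: "w = p @ (i, l) # (i, m) # s" "l \<noteq> m"
      using not_reduced_cancel by blast
    have "\<phi> (word_prod A u (p @ s)) = \<psi> (word_prod B v (p @ s))"
      using 1 w by auto
    thus ?thesis
      using A.word_prod_cancel[of I u p i l m s] B.word_prod_cancel[of I v p i l m s]
        u v w "1.prems" by (auto simp: free_unitaries_def)
  qed
qed

text \<open>One letter of a word in the scaled sum is expanded. The terms again begin with a word in the
  summands, which makes an induction over the remaining letters possible.\<close>

lemma (in star_state) state_word_times_scaled_sum:
  assumes "finite I" "u \<in> I \<rightarrow> carrier A" "fst ` set w \<subseteq> I" "r \<in> carrier A"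
  shows "\<phi> (word_prod A u w \<otimes> (eval_letter A (c \<odot> (\<Oplus>i\<in>I. u i)) l \<otimes> r)) =
    (case l of X \<Rightarrow> c | X_star \<Rightarrow> cnj c) * (\<Sum>i\<in>I. \<phi> (word_prod A u (w @ [(i, l)]) \<otimes> r))"
proof -
  define d where "d = (case l of X \<Rightarrow> c | X_star \<Rightarrow> cnj c)"
  let ?x = "\<lambda>i. eval_letter A (u i) l"
  have W: "word_prod A u w \<in> carrier A"
    using assms by (intro word_prod_closed[where I = I])
  have x: "?x \<in> I \<rightarrow> carrier A" using assms(2) by (auto simp: Pi_def)
  have "eval_letter A (c \<odot> (\<Oplus>i\<in>I. u i)) l = d \<odot> (\<Oplus>i\<in>I. ?x i)"
    using assms by (cases l) (auto simp: d_def star_smult star_finsum)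
  hence "word_prod A u w \<otimes> (eval_letter A (c \<odot> (\<Oplus>i\<in>I. u i)) l \<otimes> r) =
      d \<odot> (\<Oplus>i\<in>I. word_prod A u w \<otimes> (?x i \<otimes> r))"
    using assms W x
    by (simp add: smult_mult_left smult_mult_right finsum_ldistr finsum_rdistr Pi_def)
  also have "(\<Oplus>i\<in>I. word_prod A u w \<otimes> (?x i \<otimes> r)) = (\<Oplus>i\<in>I. word_prod A u (w @ [(i, l)]) \<otimes> r)"
  proof (intro finsum_cong' refl)
    fix i assume i: "i \<in> I"
    have "?x i \<in> carrier A" using i x by (rule Pi_mem[rotated])
    thus "word_prod A u w \<otimes> (?x i \<otimes> r) = word_prod A u (w @ [(i, l)]) \<otimes> r"
      using assms i W by (subst word_prod_append[where I = I]) (auto simp: m_assoc)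
  qed (use assms in \<open>auto intro!: m_closed word_prod_closed[where I = I]\<close>)
  also have "\<phi> (d \<odot> \<dots>) = d * (\<Sum>i\<in>I. \<phi> (word_prod A u (w @ [(i, l)]) \<otimes> r))"
    using assms
    by (subst state_smult state_finsum;
        auto intro!: finsum_closed m_closed word_prod_closed[where I = I] simp: state_finsum)
  finally show ?thesis by (simp add: d_def)
qed

text \<open>A *-moment of the sum is a combination of moments of words in the summands, with coefficients that
  depend only on the scalar and the letters.\<close>

theorem free_unitaries_same_distribution_of_sum:
  assumes A: "star_prob_space A \<phi>" and B: "star_prob_space B \<psi>"
    and u: "free_unitaries A \<phi> I u" and v: "free_unitaries B \<psi> I v" and "finite I"
  shows "star_distribution A \<phi> (c \<odot>\<^bsub>A\<^esub> (\<Oplus>\<^bsub>A\<^esub>i\<in>I. u i)) =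
         star_distribution B \<psi> (c \<odot>\<^bsub>B\<^esub> (\<Oplus>\<^bsub>B\<^esub>i\<in>I. v i))"
proof -
  interpret A: star_state A \<phi> using A by (simp add: star_state_iff)
  interpret B: star_state B \<psi> using B by (simp add: star_state_iff)
  let ?a = "c \<odot>\<^bsub>A\<^esub> (\<Oplus>\<^bsub>A\<^esub>i\<in>I. u i)" and ?b = "c \<odot>\<^bsub>B\<^esub> (\<Oplus>\<^bsub>B\<^esub>i\<in>I. v i)"
  have uc: "u \<in> I \<rightarrow> carrier A" and vc: "v \<in> I \<rightarrow> carrier B"
    using u v by (auto simp: free_unitaries_def unitary_def)
  have ab: "?a \<in> carrier A" "?b \<in> carrier B"
    using uc vc by (auto intro!: A.finsum_closed B.finsum_closed)
  have "\<phi> (word_prod A u w0 \<otimes>\<^bsub>A\<^esub> eval_word A ?a w) = \<psi> (word_prod B v w0 \<otimes>\<^bsub>B\<^esub> eval_word B ?b w)"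
    if "fst ` set w0 \<subseteq> I" for w w0
    using that
  proof (induction w arbitrary: w0)
    case Nil
    have "word_prod A u w0 \<in> carrier A" "word_prod B v w0 \<in> carrier B"
      using Nil uc vc by (auto intro!: A.word_prod_closed[where I = I] B.word_prod_closed[where I = I])
    thus ?case using free_unitaries_same_word_moments[OF A B u v Nil] by simp
  next
    case (Cons l w)
    have "\<phi> (word_prod A u (w0 @ [(i, l)]) \<otimes>\<^bsub>A\<^esub> eval_word A ?a w) =
          \<psi> (word_prod B v (w0 @ [(i, l)]) \<otimes>\<^bsub>B\<^esub> eval_word B ?b w)" if "i \<in> I" for i
      using that Cons.prems by (intro Cons.IH) auto
    thus ?case
      using A.state_word_times_scaled_sum[OF \<open>finite I\<close> uc Cons.prems, of "eval_word A ?a w" c l]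
        B.state_word_times_scaled_sum[OF \<open>finite I\<close> vc Cons.prems, of "eval_word B ?b w" c l] ab
      by simp
  qed
  from this[of "[]"] show ?thesis
    using ab by (simp add: star_distribution_def)
qed

lemma free_unitaries_sum_distribution:
  assumes A: "star_prob_space A \<phi>" "free_unitaries A \<phi> I u"
    and B: "free_haar_unitaries B \<psi> I v" and "finite I"
  shows "star_distribution A \<phi> (c \<odot>\<^bsub>A\<^esub> (\<Oplus>\<^bsub>A\<^esub>i\<in>I. u i)) =
         star_distribution B \<psi> (c \<odot>\<^bsub>B\<^esub> (\<Oplus>\<^bsub>B\<^esub>i\<in>I. v i))"
proof -
  have "star_prob_space B \<psi>" using B by (simp add: free_haar_unitaries_def)
  thus ?thesis
    using star_state.free_haar_imp_free_unitaries[of B \<psi> I v] assms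
    by (intro free_unitaries_same_distribution_of_sum) (auto simp: star_state_iff)
qed


section \<open>Twisting a free Haar unitary by orthogonal unitaries\<close>

definition alt_prod :: "('a, 'm) star_algebra_scheme \<Rightarrow> ('i \<times> 'a) list \<Rightarrow> 'a" where
  "alt_prod A zs = foldr (\<lambda>(i, x) y. x \<otimes>\<^bsub>A\<^esub> y) zs \<one>\<^bsub>A\<^esub>"

lemma (in star_ring) alt_prod_closed: "snd ` set zs \<subseteq> carrier A \<Longrightarrow> alt_prod A zs \<in> carrier A"
  by (induction zs) (auto simp: alt_prod_def)

lemma (in star_ring) alt_prod_snoc:
  "snd ` set zs \<subseteq> carrier A \<Longrightarrow> x \<in> carrier A \<Longrightarrow>
     alt_prod A (zs @ [(i, x)]) = alt_prod A zs \<otimes> x"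
proof (induction zs)
  case (Cons a zs)
  thus ?case using alt_prod_closed[of zs] by (auto simp: alt_prod_def m_assoc split: prod.splits)
qed (auto simp: alt_prod_def)

lemma sgn_letter_sign: "sgn (letter_sign l) = letter_sign l" "letter_sign l \<noteq> 0"
  by (cases l; simp)+

text \<open>A Haar unitary \<open>v\<close> that is free from a *-algebra \<open>D\<close>. Freeness enters through some set \<open>E\<close> that is
  free from \<open>D\<close> and contains the powers of \<open>v\<close>, such as the image of the functions on the circle.\<close>

locale free_from_Haar = star_state A \<phi>
  for A :: "('a, 'm) star_algebra_scheme" (structure) and \<phi> +
  fixes D E :: "'a set" and v :: 'a
  assumes free: "free_family A \<phi> UNIV (case_bool D E)"
    and D_carrier: "D \<subseteq> carrier A"
    and D_mult: "x \<in> D \<Longrightarrow> y \<in> D \<Longrightarrow> x \<otimes> y \<in> D"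
    and D_star: "x \<in> D \<Longrightarrow> star A x \<in> D"
    and D_shift: "x \<in> D \<Longrightarrow> x \<oplus> c \<odot> \<one> \<in> D"
    and v_haar: "haar_unitary A \<phi> v"
    and v_pow: "v [^] (k::int) \<in> E"
begin

lemma v_unitary: "unitary A v"
  using v_haar by (simp add: haar_unitary_altdef)

lemma D_closed [simp]: "x \<in> D \<Longrightarrow> x \<in> carrier A"
  using D_carrier by blast

lemma v_pow_closed [simp]: "v [^] (k::int) \<in> carrier A"
  using v_unitary by simp

text \<open>The index \<open>True\<close> marks the factors from \<open>D\<close> and \<open>False\<close> those from \<open>E\<close>.\<close>

definition alternating :: "(bool \<times> 'a) list \<Rightarrow> bool" where
  "alternating zs \<longleftrightarrow> distinct_adj (map fst zs) \<and>
     (\<forall>(t, z)\<in>set zs. z \<in> carrier A \<and> z \<in> (if t then D else E) \<and> \<phi> z = 0)"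

lemma alternating_closed: "alternating zs \<Longrightarrow> snd ` set zs \<subseteq> carrier A"
  by (auto simp: alternating_def)

lemma alternating_snoc_D:
  "alternating zs \<Longrightarrow> zs \<noteq> [] \<longrightarrow> \<not> fst (last zs) \<Longrightarrow> x \<in> D \<Longrightarrow> \<phi> x = 0 \<Longrightarrow>
     alternating (zs @ [(True, x)])"
  by (cases "zs = []") (auto simp: alternating_def distinct_adj_append_iff last_map)

lemma alternating_snoc_pow:
  "alternating zs \<Longrightarrow> zs \<noteq> [] \<longrightarrow> fst (last zs) \<Longrightarrow> k \<noteq> 0 \<Longrightarrow>
     alternating (zs @ [(False, v [^] (k::int))])"
  using v_haar v_pow
  by (cases "zs = []")
    (auto simp: alternating_def distinct_adj_append_iff last_map haar_unitary_altdef)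

lemma state_alternating: "alternating zs \<Longrightarrow> zs \<noteq> [] \<Longrightarrow> \<phi> (alt_prod A zs) = 0"
proof -
  assume zs: "alternating zs" "zs \<noteq> []"
  have "\<forall>(t, z)\<in>set zs. t \<in> UNIV \<and> z \<in> case_bool D E t \<and> \<phi> z = 0"
    using zs by (auto simp: alternating_def split: if_splits bool.splits)
  thus ?thesis
    using free zs unfolding free_family_def alt_prod_def alternating_def by blast
qed

lemma centre_in_D:
  assumes "x \<in> D"
  shows "x \<oplus> (- \<phi> x) \<odot> \<one> \<in> D" "\<phi> (x \<oplus> (- \<phi> x) \<odot> \<one>) = 0"
  using assms by (auto simp: D_shift state_add state_smult)

lemma state_split_centre:
  assumes "x \<in> D" "y \<in> carrier A" "z \<in> carrier A"
  shows "\<phi> (y \<otimes> (x \<otimes> z)) =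
    \<phi> ((y \<otimes> (x \<oplus> (- \<phi> x) \<odot> \<one>)) \<otimes> z) + \<phi> x * \<phi> (y \<otimes> z)"
proof -
  have "\<phi> ((y \<otimes> (x \<oplus> (- \<phi> x) \<odot> \<one>)) \<otimes> z) = \<phi> (y \<otimes> (x \<otimes> z)) + (- \<phi> x) * \<phi> (y \<otimes> z)"
    using assms by (simp add: m_assoc l_distr r_distr smult_mult_left smult_mult_right
        state_add state_smult)
  thus ?thesis by simp
qed

definition twisted_prod ::
    "('b \<times> star_letter \<Rightarrow> 'a) \<Rightarrow> ('b \<times> star_letter \<Rightarrow> 'a) \<Rightarrow> ('b \<times> star_letter) list \<Rightarrow> 'a" where
  "twisted_prod L R w =
     foldr (\<lambda>a y. L a \<otimes> (v [^] letter_sign (snd a) \<otimes> (R a \<otimes> y))) w \<one>"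

lemma twisted_prod_simps [simp]:
  "twisted_prod L R [] = \<one>"
  "twisted_prod L R (a # w) = L a \<otimes> (v [^] letter_sign (snd a) \<otimes> (R a \<otimes> twisted_prod L R w))"
  by (simp_all add: twisted_prod_def)

lemma twisted_prod_closed:
  "(\<And>a. a \<in> set w \<Longrightarrow> L a \<in> D \<and> R a \<in> D) \<Longrightarrow> twisted_prod L R w \<in> carrier A"
  by (induction w) auto

text \<open>Between two powers of \<open>v\<close> stands a factor from \<open>D\<close>. Its centred part prolongs the alternating prefix
  \<open>zs\<close>. Its scalar part merges the two powers: if their signs agree, the exponents add up to a nonzero
  number of the same sign, and if the signs differ, the scalar is 0 by assumption. So no term without
  a power of \<open>v\<close> ever arises, and all terms end as alternating products of centred elements. The
  exponent \<open>k\<close> collects the powers that have been merged so far.\<close>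

lemma state_alternating_twisted_prod:
  assumes "alternating zs" "zs \<noteq> [] \<longrightarrow> fst (last zs)" "k \<noteq> 0" "sgn k = letter_sign (snd a)"
    and "\<And>c. c \<in> set (a # w) \<Longrightarrow> L c \<in> D \<and> R c \<in> D"
    and "successively (\<lambda>a c. snd a \<noteq> snd c \<longrightarrow> \<phi> (R a \<otimes> L c) = 0) (a # w)"
  shows "\<phi> (alt_prod A zs \<otimes> (v [^] (k::int) \<otimes> (R a \<otimes> twisted_prod L R w))) = 0"
  using assms
proof (induction w arbitrary: zs k a)
  case Nil
  let ?z = "alt_prod A zs" and ?x = "R a"
  have z: "?z \<in> carrier A" using Nil alternating_closed alt_prod_closed by blast
  have x: "?x \<in> D" using Nil by auto
  let ?zs = "zs @ [(False, v [^] k)]"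
  have alt: "alternating ?zs" using alternating_snoc_pow Nil by blast
  have p: "alt_prod A ?zs = ?z \<otimes> v [^] k"
    using Nil alternating_closed by (intro alt_prod_snoc) auto
  have "alternating (?zs @ [(True, ?x \<oplus> (- \<phi> ?x) \<odot> \<one>)])"
    using alt centre_in_D[OF x] by (intro alternating_snoc_D) auto
  moreover have "alt_prod A (?zs @ [(True, ?x \<oplus> (- \<phi> ?x) \<odot> \<one>)]) =
      ?z \<otimes> v [^] k \<otimes> (?x \<oplus> (- \<phi> ?x) \<odot> \<one>)"
    using alternating_closed[OF alt] x by (subst alt_prod_snoc) (auto simp: p)
  ultimately have "\<phi> (?z \<otimes> v [^] k \<otimes> (?x \<oplus> (- \<phi> ?x) \<odot> \<one>)) = 0"
    using state_alternating by fastforce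
  moreover have "\<phi> (?z \<otimes> v [^] k) = 0"
    using state_alternating[OF alt] p by simp
  ultimately show ?case
    using state_split_centre[of ?x "?z \<otimes> v [^] k" \<one>] x z by (simp add: m_assoc)
next
  case (Cons c w)
  let ?z = "alt_prod A zs" and ?r = "v [^] letter_sign (snd c) \<otimes> (R c \<otimes> twisted_prod L R w)"
  define x where "x = R a \<otimes> L c"
  have D: "R a \<in> D" "L c \<in> D" "R c \<in> D" using Cons.prems by auto
  have z: "?z \<in> carrier A" using Cons.prems alternating_closed alt_prod_closed by blast
  have x: "x \<in> D" using D by (simp add: x_def D_mult)
  have t: "twisted_prod L R w \<in> carrier A" using Cons.prems by (intro twisted_prod_closed) auto
  hence r: "?r \<in> carrier A" using D by simp
  let ?zs = "zs @ [(False, v [^] k)]"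
  let ?y = "x \<oplus> (- \<phi> x) \<odot> \<one>"
  have alt: "alternating ?zs" using alternating_snoc_pow Cons.prems by blast
  have p: "alt_prod A ?zs = ?z \<otimes> v [^] k"
    using Cons.prems alternating_closed by (intro alt_prod_snoc) auto
  have q: "alt_prod A (?zs @ [(True, ?y)]) = ?z \<otimes> v [^] k \<otimes> ?y"
    using alternating_closed[OF alt] x by (subst alt_prod_snoc) (auto simp: p)
  have succ: "successively (\<lambda>a c. snd a \<noteq> snd c \<longrightarrow> \<phi> (R a \<otimes> L c) = 0) (c # w)"
    using Cons.prems(6) by simp
  have "\<phi> (alt_prod A (?zs @ [(True, ?y)]) \<otimes> ?r) = 0"
    using alt centre_in_D[OF x] Cons.prems succ
    by (intro Cons.IH alternating_snoc_D) (auto simp: sgn_letter_sign)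
  hence 1: "\<phi> (?z \<otimes> v [^] k \<otimes> ?y \<otimes> ?r) = 0"
    by (simp only: q)
  have 2: "\<phi> x * \<phi> (?z \<otimes> v [^] k \<otimes> ?r) = 0"
  proof (cases "snd a = snd c")
    case False
    thus ?thesis using Cons.prems(6) by (simp add: x_def)
  next
    case True
    define k' where "k' = k + letter_sign (snd c)"
    have k': "k' \<noteq> 0" "sgn k' = letter_sign (snd c)"
      using Cons.prems(3,4) True unfolding k'_def
      by (cases "snd c"; auto simp: sgn_if split: if_splits)+
    have "\<phi> (?z \<otimes> (v [^] k' \<otimes> (R c \<otimes> twisted_prod L R w))) = 0"
      using Cons.prems succ k' by (intro Cons.IH) auto
    moreover have "v [^] k' = v [^] k \<otimes> v [^] letter_sign (snd c)"
      unfolding k'_def by (rule unitary_pow_add[OF v_unitary])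
    ultimately show ?thesis using z t D by (simp add: m_assoc)
  qed
  have "?z \<otimes> (v [^] k \<otimes> (R a \<otimes> twisted_prod L R (c # w))) = ?z \<otimes> v [^] k \<otimes> (x \<otimes> ?r)"
    using z D t by (simp add: x_def m_assoc)
  thus ?case
    using state_split_centre[of x "?z \<otimes> v [^] k" ?r] x z r 1 2 by simp
qed

lemma state_twisted_prod:
  assumes "\<And>c. c \<in> set w \<Longrightarrow> L c \<in> D \<and> R c \<in> D" "w \<noteq> []"
    and "successively (\<lambda>a c. snd a \<noteq> snd c \<longrightarrow> \<phi> (R a \<otimes> L c) = 0) w"
  shows "\<phi> (twisted_prod L R w) = 0"
proof -
  obtain a w' where w: "w = a # w'" using assms(2) by (cases w) auto
  let ?r = "v [^] letter_sign (snd a) \<otimes> (R a \<otimes> twisted_prod L R w')"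
  let ?y = "L a \<oplus> (- \<phi> (L a)) \<odot> \<one>"
  have a: "L a \<in> D" "R a \<in> D" using assms w by auto
  have "twisted_prod L R w' \<in> carrier A"
    using assms(1) w by (intro twisted_prod_closed) auto
  hence r: "?r \<in> carrier A" using a by simp
  note aux = state_alternating_twisted_prod[where L = L and R = R and w = w' and a = a, OF _ _ _ _ _ assms(3)[unfolded w]]
  have "\<phi> (alt_prod A [(True, ?y)] \<otimes> ?r) = 0"
    using assms(1) w a centre_in_D[OF a(1)]
    by (intro aux) (auto simp: sgn_letter_sign alternating_def)
  hence "\<phi> (\<one> \<otimes> ?y \<otimes> ?r) = 0" using a by (simp add: alt_prod_def)
  moreover have "\<phi> (alt_prod A ([] :: (bool \<times> 'a) list) \<otimes> ?r) = 0"
    using assms(1) w by (intro aux) (auto simp: sgn_letter_sign alternating_def)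
  hence "\<phi> (\<one> \<otimes> ?r) = 0" by (simp add: alt_prod_def)
  ultimately show ?thesis
    using state_split_centre[of "L a" \<one> ?r] a r w by simp
qed

text \<open>The factors on both sides of \<open>v\<close> move the unitaries apart: where the exponent of \<open>v\<close> changes its sign,
  the factor in between is \<open>q i\<close> times the adjoint of \<open>q j\<close>, or the adjoint of \<open>p i\<close> times \<open>p j\<close>. In a
  reduced word the indices then differ, so that orthogonality makes this factor centred.\<close>

theorem twisted_Haar_free_unitaries:
  assumes p: "\<And>i. i \<in> I \<Longrightarrow> p i \<in> D \<and> unitary A (p i)"
    and q: "\<And>i. i \<in> I \<Longrightarrow> q i \<in> D \<and> unitary A (q i)"
    and p_orth: "\<And>i j. i \<in> I \<Longrightarrow> j \<in> I \<Longrightarrow> i \<noteq> j \<Longrightarrow> \<phi> (star A (p i) \<otimes> p j) = 0"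
    and q_orth: "\<And>i j. i \<in> I \<Longrightarrow> j \<in> I \<Longrightarrow> i \<noteq> j \<Longrightarrow> \<phi> (q i \<otimes> star A (q j)) = 0"
  shows "free_unitaries A \<phi> I (\<lambda>i. p i \<otimes> (v \<otimes> q i))"
proof -
  let ?u = "\<lambda>i. p i \<otimes> (v \<otimes> q i)"
  have vc: "v \<in> carrier A" "star A v \<otimes> v = \<one>" "v \<otimes> star A v = \<one>"
    using v_unitary by (auto simp: unitary_def)
  have cancel: "x \<otimes> (y \<otimes> z) = z" if "x \<otimes> y = \<one>" "x \<in> carrier A" "y \<in> carrier A" "z \<in> carrier A"
    for x y z
    using that by (metis l_one m_assoc)
  have unit: "unitary A (?u i)" if i: "i \<in> I" for i
  proof -
    have c: "p i \<in> carrier A" "q i \<in> carrier A"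
      and e: "star A (p i) \<otimes> p i = \<one>" "p i \<otimes> star A (p i) = \<one>"
        "star A (q i) \<otimes> q i = \<one>" "q i \<otimes> star A (q i) = \<one>"
      using p[OF i] q[OF i] by (auto simp: unitary_def)
    show ?thesis
      unfolding unitary_def using vc c e by (simp add: star_mult m_assoc cancel)
  qed
  define L where "L = (\<lambda>(i, l). case l of X \<Rightarrow> p i | X_star \<Rightarrow> star A (q i))"
  define R where "R = (\<lambda>(i, l). case l of X \<Rightarrow> q i | X_star \<Rightarrow> star A (p i))"
  have LR: "L (i, l) \<in> D" "R (i, l) \<in> D" if "i \<in> I" for i l
    using p[OF that] q[OF that] D_star by (cases l; simp add: L_def R_def)+
  have word: "word_prod A ?u w = twisted_prod L R w" if "fst ` set w \<subseteq> I" for w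
    using that
  proof (induction w)
    case (Cons a w)
    obtain i l where a: "a = (i, l)" by (cases a)
    have i: "i \<in> I" using Cons a by auto
    have "eval_letter A (?u i) l = L a \<otimes> (v [^] letter_sign l \<otimes> R a)"
    proof -
      have "p i \<in> carrier A" "q i \<in> carrier A"
        using p[OF i] q[OF i] by auto
      thus ?thesis
        using vc unfolding a
        by (cases l) (simp_all add: L_def R_def star_mult m_assoc
            unitary_pow_1[OF v_unitary] unitary_pow_uminus_1[OF v_unitary])
    qed
    moreover have "twisted_prod L R w \<in> carrier A"
    proof (rule twisted_prod_closed)
      fix c assume "c \<in> set w"
      hence "fst c \<in> I" using Cons.prems by auto
      thus "L c \<in> D \<and> R c \<in> D" using LR[of "fst c" "snd c"] by simp
    qed
    ultimately show ?case using Cons.IH Cons.prems LR[OF i, of l] by (simp add: a m_assoc)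
  qed simp
  have "\<phi> (word_prod A ?u w) = 0" if w: "w \<noteq> []" "fst ` set w \<subseteq> I" "reduced w" for w
  proof -
    have "successively (\<lambda>a c. snd a \<noteq> snd c \<longrightarrow> \<phi> (R a \<otimes> L c) = 0) w"
      using w(3) unfolding reduced_def
    proof (rule successively_mono)
      fix a c :: "'b \<times> star_letter"
      assume ac: "a \<in> set w" "c \<in> set w" "(case a of (i, l) \<Rightarrow> \<lambda>(j, m). i = j \<longrightarrow> l = m) c"
      obtain i l j m where eq: "a = (i, l)" "c = (j, m)" by (cases a; cases c)
      have I: "i \<in> I" "j \<in> I" using ac w(2) eq by auto
      have "\<phi> (R a \<otimes> L c) = 0" if "l \<noteq> m"
      proof -
        have "i \<noteq> j" using ac(3) eq that by auto
        thus ?thesis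
          using p_orth[OF I] q_orth[OF I] that eq by (cases l; cases m) (auto simp: L_def R_def)
      qed
      thus "snd a \<noteq> snd c \<longrightarrow> \<phi> (R a \<otimes> L c) = 0" using eq by simp
    qed
    moreover have "L c \<in> D \<and> R c \<in> D" if "c \<in> set w" for c
      using LR[of "fst c" "snd c"] w(2) that by auto
    ultimately show ?thesis
      using w by (simp add: word state_twisted_prod)
  qed
  thus ?thesis using unit by (simp add: free_unitaries_def)
qed

end

section \<open>Weyl matrices\<close>

text \<open>For \<open>k = m b + n\<close> with \<open>m, n < b\<close> this is the \<open>m\<close>-th power of the clock matrix times the \<open>n\<close>-th power
  of the cyclic shift. These \<open>b\<^sup>2\<close> matrices are unitary, and they form an orthogonal basis of the
  matrices for the inner product given by the trace.\<close>

definition weyl :: "nat \<Rightarrow> nat \<Rightarrow> nat \<times> nat \<Rightarrow> complex" where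
  "weyl b k = (\<lambda>(i, j)\<in>{1..b} \<times> {1..b}.
     if (i + k mod b) mod b = j mod b then cis (2 * pi * real (k div b) * real i / real b) else 0)"

text \<open>The first range is that of the exponents of the clock matrix, the second one that of the matrix
  indices.\<close>

lemma sum_roots_of_unity:
  fixes b :: nat and t :: int
  assumes "b \<ge> 1"
  shows "(\<Sum>m<b. cis (2 * pi * t / b) ^ m) = (if int b dvd t then of_nat b else 0)" (is ?first)
    and "(\<Sum>m=1..b. cis (2 * pi * t / b) ^ m) = (if int b dvd t then of_nat b else 0)" (is ?second)
proof -
  define z where "z = cis (2 * pi * t / b)"
  have zb: "z ^ b = 1"
  proof -
    have "z ^ b = cis (2 * pi * t)" using assms by (simp add: z_def DeMoivre)
    thus ?thesis by simp
  qed
  have z1: "z = 1 \<longleftrightarrow> int b dvd t"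
  proof
    assume "z = 1"
    hence "cos (2 * pi * t / b) = 1" by (auto simp: z_def complex_eq_iff)
    then obtain n :: int where "2 * pi * t / b = n * 2 * pi" by (auto simp: cos_one_2pi_int)
    hence "real_of_int t = real_of_int (n * int b)" using assms by (simp add: field_simps)
    hence "t = n * int b" by (simp only: of_int_eq_iff)
    thus "int b dvd t" by simp
  next
    assume "int b dvd t"
    then obtain n where "t = int b * n" by blast
    hence "2 * pi * t / b = 2 * pi * real_of_int n" using assms by simp
    thus "z = 1" by (simp add: z_def)
  qed
  have first: "(\<Sum>m<b. z ^ m) = (if int b dvd t then of_nat b else 0)"
  proof (cases "z = 1")
    case False
    have "(\<Sum>m<b. z ^ m) = (z ^ b - 1) / (z - 1)" using False by (intro geometric_sum)
    thus ?thesis using False zb z1 by simp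
  qed (use z1 in auto)
  have "(\<Sum>m=1..b. z ^ m) = (\<Sum>m<b. z ^ Suc m)"
    by (rule sum.reindex_bij_witness[of _ Suc "\<lambda>m. m - 1"]) auto
  also have "\<dots> = z * (\<Sum>m<b. z ^ m)" by (simp add: sum_distrib_left)
  also have "\<dots> = (\<Sum>m<b. z ^ m)" using first z1 by auto
  finally show ?second using first by (simp add: z_def)
  show ?first using first by (simp add: z_def)
qed

lemma dvd_diff_bounded:
  "i < n \<Longrightarrow> j < n \<Longrightarrow> int n dvd int i - int j \<longleftrightarrow> i = j"
  "i \<in> {1..n} \<Longrightarrow> j \<in> {1..n} \<Longrightarrow> int n dvd int i - int j \<longleftrightarrow> i = j"
proof -
  have *: "\<bar>int i - int j\<bar> < int n \<Longrightarrow> int n dvd int i - int j \<longleftrightarrow> i = j"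
    using dvd_imp_le_int[of "int i - int j" "int n"] by auto
  show "i < n \<Longrightarrow> j < n \<Longrightarrow> int n dvd int i - int j \<longleftrightarrow> i = j"
    and "i \<in> {1..n} \<Longrightarrow> j \<in> {1..n} \<Longrightarrow> int n dvd int i - int j \<longleftrightarrow> i = j"
    by (rule *; auto)+
qed

context
  fixes b :: nat
  assumes b: "b \<ge> 1"
begin

definition phase :: "nat \<Rightarrow> nat \<Rightarrow> complex" where
  "phase m i = cis (2 * pi * real m * real i / real b)"

definition shift :: "nat \<Rightarrow> nat \<Rightarrow> nat \<Rightarrow> complex" where
  "shift n i j = of_bool ((i + n) mod b = j mod b)"

lemma weyl_eq:
  "i \<in> {1..b} \<Longrightarrow> j \<in> {1..b} \<Longrightarrow> weyl b k (i, j) = phase (k div b) i * shift (k mod b) i j"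
  by (simp add: weyl_def phase_def shift_def)

lemma phase_norm: "phase m i * cnj (phase m i) = 1"
  by (simp add: phase_def cis_cnj cis_mult)

lemma phase_orth_index:
  assumes "i \<in> {1..b}" "r \<in> {1..b}"
  shows "(\<Sum>m<b. phase m i * cnj (phase m r)) = (if i = r then of_nat b else 0)"
proof -
  have "phase m i * cnj (phase m r) = cis (2 * pi * of_int (int i - int r) / b) ^ m" for m
    by (simp add: phase_def cis_cnj cis_mult DeMoivre diff_divide_distrib algebra_simps)
  thus ?thesis
    using sum_roots_of_unity(1)[OF b, of "int i - int r"] dvd_diff_bounded(2)[OF assms] by simp
qed

lemma phase_orth:
  assumes "m < b" "l < b"
  shows "(\<Sum>i=1..b. cnj (phase m i) * phase l i) = (if m = l then of_nat b else 0)"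
proof -
  have "cnj (phase m i) * phase l i = cis (2 * pi * of_int (int l - int m) / b) ^ i" for i
    by (simp add: phase_def cis_cnj cis_mult DeMoivre diff_divide_distrib algebra_simps)
  thus ?thesis
    using sum_roots_of_unity(2)[OF b, of "int l - int m"] dvd_diff_bounded(1)[OF assms(2,1)]
    by auto
qed

text \<open>As a divisibility of integers the relation between \<open>n\<close>, \<open>i\<close> and \<open>j\<close> is symmetric enough to be solved for
  any one of the three. In the orthogonality relations below, one of them is summed over and thereby
  determined by the first factor.\<close>

lemma shift_iff: "shift n i j = of_bool (int b dvd int i + int n - int j)"
proof -
  have "(i + n) mod b = j mod b \<longleftrightarrow> int (i + n) mod int b = int j mod int b"
    by (metis of_nat_eq_iff zmod_int)
  also have "\<dots> \<longleftrightarrow> int b dvd int i + int n - int j"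
    by (simp add: mod_eq_dvd_iff)
  finally show ?thesis by (simp add: shift_def)
qed

lemma shift_solve:
  fixes t :: int
  shows "\<exists>n<b. int b dvd t - int n" and "\<exists>j\<in>{1..b}. int b dvd t - int j"
proof -
  let ?n = "nat (t mod int b)"
  have n: "?n < b" "int ?n = t mod int b" using b by (auto simp: nat_less_iff)
  have d: "int b dvd t - int ?n" unfolding n(2) by (simp add: minus_mod_eq_mult_div)
  show "\<exists>n<b. int b dvd t - int n" using n d by blast
  show "\<exists>j\<in>{1..b}. int b dvd t - int j"
  proof (cases "?n = 0")
    case True
    hence "int b dvd t" using d by simp
    thus ?thesis using b by (intro bexI[of _ b]) auto
  next
    case False
    thus ?thesis using n d by (intro bexI[of _ ?n]) auto
  qed
qed

lemma sum_shift_product: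
  assumes "finite F" "x \<in> F" "\<And>y. y \<in> F \<Longrightarrow> P y \<longleftrightarrow> y = x"
  shows "(\<Sum>y\<in>F. of_bool (P y) * of_bool (Q y)) = (of_bool (Q x) :: complex)"
proof -
  have "(\<Sum>y\<in>F. of_bool (P y) * of_bool (Q y)) = (\<Sum>y\<in>F. if y = x then of_bool (Q y) else (0::complex))"
    using assms(3) by (intro sum.cong) auto
  thus ?thesis using assms by simp
qed

lemma shift_orth_col:
  assumes "i \<in> {1..b}" "r \<in> {1..b}"
  shows "(\<Sum>j=1..b. shift n i j * shift n r j) = of_bool (i = r)"
proof -
  obtain x where x: "x \<in> {1..b}" "int b dvd (int i + int n) - int x" using shift_solve(2) by blast
  have "(\<Sum>j=1..b. shift n i j * shift n r j) = of_bool (int b dvd int r + int n - int x)"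
    unfolding shift_iff
  proof (rule sum_shift_product)
    fix j assume "j \<in> {1..b}"
    have "int b dvd int i + int n - int j \<longleftrightarrow> int b dvd int j - int x"
      using dvd_diff[OF x(2), of "int i + int n - int j"] dvd_diff[OF x(2), of "int j - int x"]
      by (auto simp: algebra_simps)
    thus "int b dvd int i + int n - int j \<longleftrightarrow> j = x"
      using dvd_diff_bounded(2)[OF \<open>j \<in> {1..b}\<close> x(1)] by simp
  qed (use x in auto)
  also have "int b dvd int r + int n - int x \<longleftrightarrow> int b dvd int i - int r"
    using dvd_diff[OF x(2), of "int r + int n - int x"] dvd_diff[OF x(2), of "int i - int r"]
    by (auto simp: algebra_simps)
  also have "\<dots> \<longleftrightarrow> i = r" by (rule dvd_diff_bounded(2)[OF assms])
  finally show ?thesis .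
qed

lemma shift_orth_row:
  assumes "j \<in> {1..b}" "s \<in> {1..b}"
  shows "(\<Sum>i=1..b. shift n i j * shift n i s) = of_bool (j = s)"
proof -
  obtain x where x: "x \<in> {1..b}" "int b dvd (int j - int n) - int x" using shift_solve(2) by blast
  have "(\<Sum>i=1..b. shift n i j * shift n i s) = of_bool (int b dvd int x + int n - int s)"
    unfolding shift_iff
  proof (rule sum_shift_product)
    fix i assume "i \<in> {1..b}"
    have "int b dvd int i + int n - int j \<longleftrightarrow> int b dvd int i - int x"
      using dvd_add[OF x(2), of "int i + int n - int j"] dvd_diff[of _ "int i - int x", OF _ x(2)]
      by (auto simp: algebra_simps)
    thus "int b dvd int i + int n - int j \<longleftrightarrow> i = x"
      using dvd_diff_bounded(2)[OF \<open>i \<in> {1..b}\<close> x(1)] by simp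
  qed (use x in auto)
  also have "int b dvd int x + int n - int s \<longleftrightarrow> int b dvd int j - int s"
    using dvd_add[OF x(2), of "int x + int n - int s"] dvd_diff[of _ "int j - int s", OF _ x(2)]
    by (auto simp: algebra_simps)
  also have "\<dots> \<longleftrightarrow> j = s" by (rule dvd_diff_bounded(2)[OF assms])
  finally show ?thesis .
qed

lemma shift_orth_amount:
  assumes "j \<in> {1..b}" "s \<in> {1..b}"
  shows "(\<Sum>n<b. shift n i j * shift n i s) = of_bool (j = s)"
proof -
  obtain x where x: "x < b" "int b dvd (int j - int i) - int x" using shift_solve(1) by blast
  have "(\<Sum>n<b. shift n i j * shift n i s) = of_bool (int b dvd int i + int x - int s)"
    unfolding shift_iff
  proof (rule sum_shift_product)
    fix n assume "n \<in> {..<b}"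
    have "int b dvd int i + int n - int j \<longleftrightarrow> int b dvd int n - int x"
      using dvd_add[OF x(2), of "int i + int n - int j"] dvd_diff[of _ "int n - int x", OF _ x(2)]
      by (auto simp: algebra_simps)
    thus "int b dvd int i + int n - int j \<longleftrightarrow> n = x"
      using dvd_diff_bounded(1)[OF _ x(1)] \<open>n \<in> {..<b}\<close> by auto
  qed (use x in auto)
  also have "int b dvd int i + int x - int s \<longleftrightarrow> int b dvd int j - int s"
    using dvd_add[OF x(2), of "int i + int x - int s"] dvd_diff[of _ "int j - int s", OF _ x(2)]
    by (auto simp: algebra_simps)
  also have "\<dots> \<longleftrightarrow> j = s" by (rule dvd_diff_bounded(2)[OF assms])
  finally show ?thesis .
qed

lemma shift_amounts_disjoint:
  assumes "n < b" "l < b"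
  shows "(\<Sum>j=1..b. shift n i j * shift l i j) = of_bool (n = l)"
proof -
  obtain x where x: "x \<in> {1..b}" "int b dvd (int i + int n) - int x" using shift_solve(2) by blast
  have "(\<Sum>j=1..b. shift n i j * shift l i j) = of_bool (int b dvd int i + int l - int x)"
    unfolding shift_iff
  proof (rule sum_shift_product)
    fix j assume "j \<in> {1..b}"
    have "int b dvd int i + int n - int j \<longleftrightarrow> int b dvd int j - int x"
      using dvd_diff[OF x(2), of "int i + int n - int j"] dvd_diff[OF x(2), of "int j - int x"]
      by (auto simp: algebra_simps)
    thus "int b dvd int i + int n - int j \<longleftrightarrow> j = x"
      using dvd_diff_bounded(2)[OF \<open>j \<in> {1..b}\<close> x(1)] by simp
  qed (use x in auto)
  also have "int b dvd int i + int l - int x \<longleftrightarrow> int b dvd int n - int l"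
    using dvd_diff[OF x(2), of "int i + int l - int x"] dvd_diff[OF x(2), of "int n - int l"]
    by (auto simp: algebra_simps)
  also have "\<dots> \<longleftrightarrow> n = l" by (rule dvd_diff_bounded(1)[OF assms])
  finally show ?thesis .
qed

lemma cnj_shift [simp]: "cnj (shift n i j) = shift n i j"
  by (simp add: shift_def)

lemma weyl_unitary_row:
  assumes "i \<in> {1..b}" "r \<in> {1..b}"
  shows "(\<Sum>j=1..b. weyl b k (i, j) * cnj (weyl b k (r, j))) = of_bool (i = r)"
proof -
  have "(\<Sum>j=1..b. weyl b k (i, j) * cnj (weyl b k (r, j))) =
      phase (k div b) i * cnj (phase (k div b) r) *
      (\<Sum>j=1..b. shift (k mod b) i j * shift (k mod b) r j)"
    unfolding sum_distrib_left using assms by (intro sum.cong) (auto simp: weyl_eq)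
  thus ?thesis using shift_orth_col[OF assms] phase_norm by auto
qed

lemma weyl_unitary_col:
  assumes "j \<in> {1..b}" "s \<in> {1..b}"
  shows "(\<Sum>i=1..b. cnj (weyl b k (i, j)) * weyl b k (i, s)) = of_bool (j = s)"
proof -
  have "(\<Sum>i=1..b. cnj (weyl b k (i, j)) * weyl b k (i, s)) =
      (\<Sum>i=1..b. (phase (k div b) i * cnj (phase (k div b) i)) *
          (shift (k mod b) i j * shift (k mod b) i s))"
    using assms by (intro sum.cong) (auto simp: weyl_eq)
  thus ?thesis using shift_orth_row[OF assms] by (simp only: phase_norm mult_1)
qed

text \<open>Different shifts have disjoint supports. For equal shifts the clock matrices contribute a sum over
  a nontrivial character of the integers modulo \<open>b\<close>.\<close>

lemma weyl_orthogonal: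
  assumes "k < b\<^sup>2" "l < b\<^sup>2" "k \<noteq> l"
  shows "(\<Sum>i=1..b. \<Sum>j=1..b. cnj (weyl b k (i, j)) * weyl b l (i, j)) = 0"
proof -
  have "(\<Sum>j=1..b. cnj (weyl b k (i, j)) * weyl b l (i, j)) =
      cnj (phase (k div b) i) * phase (l div b) i * of_bool (k mod b = l mod b)"
    if "i \<in> {1..b}" for i
  proof -
    have "(\<Sum>j=1..b. cnj (weyl b k (i, j)) * weyl b l (i, j)) =
       cnj (phase (k div b) i) * phase (l div b) i *
       (\<Sum>j=1..b. shift (k mod b) i j * shift (l mod b) i j)"
      unfolding sum_distrib_left using that by (intro sum.cong) (auto simp: weyl_eq)
    thus ?thesis using b by (subst (asm) shift_amounts_disjoint) auto
  qed
  hence "(\<Sum>i=1..b. \<Sum>j=1..b. cnj (weyl b k (i, j)) * weyl b l (i, j)) =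
      (\<Sum>i=1..b. cnj (phase (k div b) i) * phase (l div b) i) * of_bool (k mod b = l mod b)"
    by (simp add: sum_distrib_right)
  also have "\<dots> = 0"
  proof (cases "k mod b = l mod b")
    case True
    hence "k div b \<noteq> l div b" using assms(3) by (metis div_mult_mod_eq)
    moreover have "k div b < b" "l div b < b"
      using assms by (auto simp: less_mult_imp_div_less power2_eq_square)
    ultimately show ?thesis using phase_orth[of "k div b" "l div b"] by simp
  qed simp
  finally show ?thesis .
qed

lemma sum_div_mod:
  fixes f :: "nat \<Rightarrow> nat \<Rightarrow> complex"
  shows "(\<Sum>k<b\<^sup>2. f (k div b) (k mod b)) = (\<Sum>m<b. \<Sum>n<b. f m n)"
proof -
  have "m * b + n < b\<^sup>2" if "m < b" "n < b" for m n
  proof -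
    have "m * b + n < Suc m * b" using that by simp
    also have "\<dots> \<le> b * b" using that by (intro mult_right_mono) auto
    finally show ?thesis by (simp add: power2_eq_square)
  qed
  thus ?thesis
    unfolding sum.cartesian_product using b
    by (intro sum.reindex_bij_witness[of _ "\<lambda>(m, n). m * b + n" "\<lambda>k. (k div b, k mod b)"])
       (auto simp: less_mult_imp_div_less power2_eq_square)
qed

text \<open>This says that the sum of all \<open>W \<otimes> cnj W\<close> is \<open>b\<close> times the sum of all \<open>e\<^sub>i\<^sub>j \<otimes> e\<^sub>i\<^sub>j\<close>: the tensor belonging to
  an orthonormal basis and its complex conjugate does not depend on the basis.\<close>

lemma weyl_complete:
  assumes "i \<in> {1..b}" "j \<in> {1..b}" "r \<in> {1..b}" "s \<in> {1..b}"
  shows "(\<Sum>k<b\<^sup>2. weyl b k (i, j) * cnj (weyl b k (r, s))) = (if i = r \<and> j = s then of_nat b else 0)"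
proof -
  have "(\<Sum>k<b\<^sup>2. weyl b k (i, j) * cnj (weyl b k (r, s))) =
      (\<Sum>k<b\<^sup>2. phase (k div b) i * cnj (phase (k div b) r) * (shift (k mod b) i j * shift (k mod b) r s))"
    using assms by (intro sum.cong) (auto simp: weyl_eq)
  also have "\<dots> = (\<Sum>m<b. \<Sum>n<b. phase m i * cnj (phase m r) * (shift n i j * shift n r s))"
    by (rule sum_div_mod)
  also have "\<dots> = (\<Sum>m<b. phase m i * cnj (phase m r)) * (\<Sum>n<b. shift n i j * shift n r s)"
    by (rule sum_product[symmetric])
  also have "\<dots> = (if i = r \<and> j = s then of_nat b else 0)"
    using phase_orth_index[OF assms(1,3)] shift_orth_amount[OF assms(2,4)] by auto
  finally show ?thesis .
qed

end

section \<open>The characters of the circle\<close>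

definition circle_char :: "int \<Rightarrow> complex \<Rightarrow> complex" where
  "circle_char k = (\<lambda>z\<in>sphere 0 1. z powi k)"

lemma circle_char_closed: "circle_char k \<in> carrier circle_algebra"
proof -
  have "continuous_on (sphere 0 1) (\<lambda>z::complex. z powi k)"
    by (intro continuous_intros) auto
  moreover have "continuous_on (sphere 0 1) (circle_char k) \<longleftrightarrow>
      continuous_on (sphere 0 1) (\<lambda>z::complex. z powi k)"
    by (rule continuous_on_cong) (auto simp: circle_char_def)
  ultimately show ?thesis
    by (simp add: circle_char_def circle_algebra_def)
qed

lemma circle_char_0: "circle_char 0 = \<one>\<^bsub>circle_algebra\<^esub>"
  by (auto simp: circle_char_def circle_algebra_def)

lemma circle_char_1: "circle_char 1 = circle_id"
  by (auto simp: circle_char_def circle_id_def)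

lemma circle_char_add: "circle_char (k + m) = circle_char k \<otimes>\<^bsub>circle_algebra\<^esub> circle_char m"
proof -
  have "z powi (k + m) = z powi k * z powi m" if "norm z = 1" for z :: complex
    using that by (intro power_int_add disjI1) auto
  thus ?thesis by (auto simp: circle_char_def circle_algebra_def intro!: restrict_ext)
qed

lemma circle_char_star: "star circle_algebra (circle_char k) = circle_char (- k)"
proof -
  have "cnj (z powi k) = z powi (- k)" if "norm z = 1" for z :: complex
  proof -
    have "z * cnj z = 1" using that complex_norm_square[of z] by simp
    hence z: "cnj z = inverse z" by (rule inverse_unique[symmetric])
    have "cnj (z powi k) = cnj z powi k" by (simp add: power_int_def)
    thus ?thesis by (simp add: z power_int_minus power_int_inverse)
  qed
  thus ?thesis by (auto simp: circle_char_def circle_algebra_def intro!: restrict_ext)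
qed

lemma haar_integral_circle_char:
  assumes "k \<noteq> 0"
  shows "haar_integral (circle_char k) = 0"
proof -
  let ?F = "\<lambda>t. cis (of_int k * t) / (\<i> * of_int k)"
  have "((\<lambda>t. cis (of_int k * t)) has_integral (?F (2 * pi) - ?F 0)) {0..2*pi}"
  proof (rule fundamental_theorem_of_calculus)
    have ii: "\<i> * (of_real h * (\<i> * z)) = - (of_real h * z)" for h :: real and z
      by (simp add: mult.left_commute[of \<i> "of_real h"])
    fix t :: real
    assume "t \<in> {0..2*pi}"
    show "(?F has_vector_derivative cis (of_int k * t)) (at t within {0..2*pi})"
      unfolding has_vector_derivative_def using assms
      by (auto intro!: derivative_eq_intros simp: scaleR_conv_of_real ii)
  qed simp
  moreover have "cis (of_int k * (2 * pi)) = 1"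
    using cis_multiple_2pi[of "of_int k"] by (simp add: mult.commute)
  ultimately have "integral {0..2*pi} (\<lambda>t. cis (of_int k * t)) = 0"
    by (simp add: integral_unique)
  thus ?thesis by (simp add: haar_integral_def circle_char_def cis_power_int)
qed

lemma circle_id_powers:
  assumes "star_prob_space A \<phi>" "\<iota> \<in> star_hom circle_algebra A"
    and state: "\<And>f. f \<in> carrier circle_algebra \<Longrightarrow> \<phi> (\<iota> f) = haar_integral f"
  shows "haar_unitary A \<phi> (\<iota> circle_id)"
    and "\<iota> circle_id [^]\<^bsub>A\<^esub> (k::int) \<in> \<iota> ` carrier circle_algebra"
proof -
  interpret star_state A \<phi> using assms(1) by (simp add: star_state_iff)
  define g where "g = (\<lambda>k. \<iota> (circle_char k))"
  have mult: "g (k + m) = g k \<otimes>\<^bsub>A\<^esub> g m" for k m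
    using assms(2) circle_char_closed
    by (auto simp: g_def star_hom_def ring_hom_def circle_char_add)
  have one: "g 0 = \<one>\<^bsub>A\<^esub>"
    using assms(2) by (simp add: g_def star_hom_def ring_hom_def circle_char_0)
  have st: "star A (g k) = g (- k)" for k
    using assms(2) circle_char_closed[of k]
    by (simp add: g_def star_hom_def circle_char_star[symmetric])
  have "g 1 \<in> carrier A"
    using assms(2) circle_char_closed[of 1] by (auto simp: g_def star_hom_def ring_hom_def)
  hence u: "unitary A (g 1)"
    using mult[of 1 "-1"] mult[of "-1" 1] by (simp add: unitary_def st one)
  have pow: "g 1 [^]\<^bsub>A\<^esub> k = g k" for k :: int
  proof (induction k rule: int_induct[where k = 0])
    case base
    show ?case by (simp add: one)
  next
    case (step1 i)
    show ?case by (simp only: unitary_pow_add[OF u] unitary_pow_1[OF u] step1 mult)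
  next
    case (step2 i)
    have "g 1 [^]\<^bsub>A\<^esub> (i + - 1) = g (i + - 1)"
      by (simp only: unitary_pow_add[OF u] unitary_pow_uminus_1[OF u] step2 mult st)
    thus ?case by simp
  qed
  have v: "\<iota> circle_id = g 1" by (simp add: g_def circle_char_1)
  show "haar_unitary A \<phi> (\<iota> circle_id)"
    unfolding v haar_unitary_altdef pow
    using u by (auto simp: g_def state circle_char_closed haar_integral_circle_char)
  show "\<iota> circle_id [^]\<^bsub>A\<^esub> k \<in> \<iota> ` carrier circle_algebra"
    unfolding v pow by (simp add: g_def circle_char_closed)
qed


section \<open>Images of matrices in a *-algebra\<close>

(* Matrix indices start at 1. Rewriting 1 to Suc 0 would hide the range {1..b} from the lemmas
   about it. *)
declare One_nat_def [simp del]

lemma finsum_complex_algebra: "finite F \<Longrightarrow> finsum complex_algebra f F = sum f F"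
proof -
  have "\<exists>x. z + x = 0 \<and> x + z = 0" for z :: complex by (rule exI[of _ "- z"]) simp
  hence "ring complex_algebra"
    by unfold_locales (auto simp: complex_algebra_def Units_def algebra_simps)
  then interpret C: ring complex_algebra .
  show "finite F \<Longrightarrow> finsum complex_algebra f F = sum f F"
  proof (induction F rule: finite_induct)
    case (insert x F)
    thus ?case by (subst C.finsum_insert) (simp_all add: complex_algebra_def)
  qed (simp add: complex_algebra_def C.finsum_empty[unfolded complex_algebra_def])
qed

lemma mat_complex_carrier: "carrier (mat_algebra b complex_algebra) = extensional ({1..b} \<times> {1..b})"
  by (simp add: mat_algebra_def complex_algebra_def PiE_UNIV_domain PiE_def)

lemma mat_complex_mult:
  "S \<otimes>\<^bsub>mat_algebra b complex_algebra\<^esub> T =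
     (\<lambda>(i, j)\<in>{1..b} \<times> {1..b}. \<Sum>k=1..b. S (i, k) * T (k, j))"
  by (simp add: mat_algebra_def finsum_complex_algebra) (simp add: complex_algebra_def)

locale matrix_units = star_ring A for A :: "('a, 'm) star_algebra_scheme" (structure) +
  fixes b :: nat and \<iota> :: "(nat \<times> nat \<Rightarrow> complex) \<Rightarrow> 'a"
  assumes b_pos: "b \<ge> 1" and \<iota>_hom: "\<iota> \<in> star_hom (mat_algebra b complex_algebra) A"
begin

abbreviation "P \<equiv> {1..b} \<times> {1..b}"

definition e :: "nat \<Rightarrow> nat \<Rightarrow> 'a" where
  "e i j = \<iota> (mat_unit b i j)"

lemma \<iota>_closed [simp]: "S \<in> extensional P \<Longrightarrow> \<iota> S \<in> carrier A"
  using \<iota>_hom by (auto simp: star_hom_def ring_hom_def mat_complex_carrier)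

lemma \<iota>_mult:
  "S \<in> extensional P \<Longrightarrow> T \<in> extensional P \<Longrightarrow>
     \<iota> S \<otimes> \<iota> T = \<iota> (\<lambda>(i, j)\<in>P. \<Sum>k=1..b. S (i, k) * T (k, j))"
  using \<iota>_hom unfolding star_hom_def ring_hom_def mat_complex_carrier
  by (auto simp: mat_complex_mult)

lemma \<iota>_add:
  "S \<in> extensional P \<Longrightarrow> T \<in> extensional P \<Longrightarrow> \<iota> S \<oplus> \<iota> T = \<iota> (\<lambda>p\<in>P. S p + T p)"
proof -
  assume ST: "S \<in> extensional P" "T \<in> extensional P"
  hence "\<iota> S \<oplus> \<iota> T = \<iota> (S \<oplus>\<^bsub>mat_algebra b complex_algebra\<^esub> T)"
    using \<iota>_hom unfolding star_hom_def ring_hom_def mat_complex_carrier by auto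
  also have "S \<oplus>\<^bsub>mat_algebra b complex_algebra\<^esub> T = (\<lambda>p\<in>P. S p + T p)"
    by (auto simp: mat_algebra_def complex_algebra_def intro!: restrict_ext)
  finally show ?thesis .
qed

lemma \<iota>_one: "\<iota> (\<lambda>(i, j)\<in>P. of_bool (i = j)) = \<one>"
proof -
  have "\<one> = \<iota> \<one>\<^bsub>mat_algebra b complex_algebra\<^esub>"
    using \<iota>_hom by (auto simp: star_hom_def ring_hom_def)
  also have "\<one>\<^bsub>mat_algebra b complex_algebra\<^esub> = (\<lambda>(i, j)\<in>P. of_bool (i = j))"
    by (auto simp: mat_algebra_def complex_algebra_def intro!: restrict_ext)
  finally show ?thesis by (rule sym)
qed

lemma \<iota>_star: "S \<in> extensional P \<Longrightarrow> star A (\<iota> S) = \<iota> (\<lambda>(i, j)\<in>P. cnj (S (j, i)))"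
proof -
  assume "S \<in> extensional P"
  hence "star A (\<iota> S) = \<iota> (star (mat_algebra b complex_algebra) S)"
    using \<iota>_hom unfolding star_hom_def mat_complex_carrier by auto
  also have "star (mat_algebra b complex_algebra) S = (\<lambda>(i, j)\<in>P. cnj (S (j, i)))"
    by (simp add: mat_algebra_def complex_algebra_def)
  finally show ?thesis .
qed

lemma \<iota>_smult: "S \<in> extensional P \<Longrightarrow> c \<odot> \<iota> S = \<iota> (\<lambda>p\<in>P. c * S p)"
proof -
  assume "S \<in> extensional P"
  hence "c \<odot> \<iota> S = \<iota> (c \<odot>\<^bsub>mat_algebra b complex_algebra\<^esub> S)"
    using \<iota>_hom unfolding star_hom_def mat_complex_carrier by auto
  also have "c \<odot>\<^bsub>mat_algebra b complex_algebra\<^esub> S = (\<lambda>p\<in>P. c * S p)"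
    by (auto simp: mat_algebra_def complex_algebra_def intro!: restrict_ext)
  finally show ?thesis .
qed

lemma \<iota>_zero: "\<iota> (\<lambda>p\<in>P. 0) = \<zero>"
  using \<iota>_smult[of "\<lambda>p\<in>P. 0" 0] by (simp cong: restrict_cong)

lemma \<iota>_sum:
  assumes "finite F" "\<And>x. x \<in> F \<Longrightarrow> S x \<in> extensional P"
  shows "\<iota> (\<lambda>p\<in>P. \<Sum>x\<in>F. S x p) = (\<Oplus>x\<in>F. \<iota> (S x))"
  using assms
proof (induction F rule: finite_induct)
  case (insert x F)
  have "(\<lambda>p\<in>P. \<Sum>x\<in>insert x F. S x p) = (\<lambda>p\<in>P. S x p + (\<lambda>p\<in>P. \<Sum>x\<in>F. S x p) p)"
    using insert by (intro restrict_ext) simp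
  hence "\<iota> (\<lambda>p\<in>P. \<Sum>x\<in>insert x F. S x p) = \<iota> (S x) \<oplus> \<iota> (\<lambda>p\<in>P. \<Sum>x\<in>F. S x p)"
    using insert.prems \<iota>_add[of "S x" "\<lambda>p\<in>P. \<Sum>x\<in>F. S x p"]
    by (metis insertI1 restrict_extensional)
  also have "\<iota> (\<lambda>p\<in>P. \<Sum>x\<in>F. S x p) = (\<Oplus>x\<in>F. \<iota> (S x))"
    using insert.prems by (intro insert.IH) simp
  also have "\<iota> (S x) \<oplus> (\<Oplus>x\<in>F. \<iota> (S x)) = (\<Oplus>x\<in>insert x F. \<iota> (S x))"
    using insert by (intro finsum_insert[symmetric]) auto
  finally show ?case .
qed (simp add: \<iota>_zero)

lemma mat_unit_extensional [simp]: "mat_unit b i j \<in> extensional P"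
  by (simp add: mat_unit_def)

lemma e_closed [simp]: "e i j \<in> carrier A"
  by (simp add: e_def)

lemma e_mult:
  assumes "i \<in> {1..b}" "j \<in> {1..b}" "k \<in> {1..b}" "l \<in> {1..b}"
  shows "e i j \<otimes> e k l = (if j = k then e i l else \<zero>)"
proof -
  have "e i j \<otimes> e k l = \<iota> (\<lambda>(p, q)\<in>P. \<Sum>r=1..b. mat_unit b i j (p, r) * mat_unit b k l (r, q))"
    by (simp add: e_def \<iota>_mult)
  also have "(\<lambda>(p, q)\<in>P. \<Sum>r=1..b. mat_unit b i j (p, r) * mat_unit b k l (r, q)) =
      (if j = k then mat_unit b i l else (\<lambda>p\<in>P. 0))" (is "?l = ?r")
  proof (rule extensionalityI)
    fix x assume "x \<in> P"
    then obtain p q where x: "x = (p, q)" "p \<in> {1..b}" "q \<in> {1..b}" by blast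
    have "(\<Sum>r=1..b. mat_unit b i j (p, r) * mat_unit b k l (r, q)) =
        (\<Sum>r=1..b. if r = j then of_bool (p = i \<and> j = k \<and> q = l) else 0)"
      using x assms by (intro sum.cong) (auto simp: mat_unit_def)
    also have "\<dots> = of_bool (p = i \<and> j = k \<and> q = l)" using assms by simp
    finally show "?l x = ?r x" using x assms by (auto simp: mat_unit_def)
  qed auto
  also have "\<iota> \<dots> = (if j = k then e i l else \<zero>)"
    by (simp only: e_def \<iota>_zero if_distrib[of \<iota>])
  finally show ?thesis .
qed

lemma e_star:
  assumes "i \<in> {1..b}" "j \<in> {1..b}"
  shows "star A (e i j) = e j i"
proof -
  have "(\<lambda>(p, q)\<in>P. cnj (mat_unit b i j (q, p))) = mat_unit b j i"
    using assms by (intro extensionalityI[of _ P]) (auto simp: mat_unit_def split: if_splits)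
  thus ?thesis by (simp add: e_def \<iota>_star)
qed

lemma e_sum: "(\<Oplus>i\<in>{1..b}. e i i) = \<one>"
proof -
  have "(\<lambda>(i, j)\<in>P. of_bool (i = j)) = (\<lambda>p\<in>P. \<Sum>i\<in>{1..b}. mat_unit b i i p)"
  proof (intro restrict_ext, clarify)
    fix i j assume ij: "i \<in> {1..b}" "j \<in> {1..b}"
    have "(\<Sum>k\<in>{1..b}. mat_unit b k k (i, j)) = (\<Sum>k\<in>{1..b}. if k = i then of_bool (i = j) else 0)"
      using ij by (intro sum.cong) (auto simp: mat_unit_def)
    thus "(of_bool (i = j) :: complex) = (\<Sum>k\<in>{1..b}. mat_unit b k k (i, j))"
      using ij by simp
  qed
  thus ?thesis using \<iota>_one \<iota>_sum[of "{1..b}" "\<lambda>i. mat_unit b i i"] by (simp add: e_def)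
qed

lemma \<iota>_expand:
  assumes "S \<in> extensional P"
  shows "\<iota> S = (\<Oplus>p\<in>P. S p \<odot> e (fst p) (snd p))"
proof -
  have "S = (\<lambda>p\<in>P. \<Sum>q\<in>P. (\<lambda>p\<in>P. S q * mat_unit b (fst q) (snd q) p) p)"
  proof (rule extensionalityI[OF assms])
    fix p assume p: "p \<in> P"
    have "(\<Sum>q\<in>P. (\<lambda>p\<in>P. S q * mat_unit b (fst q) (snd q) p) p) = (\<Sum>q\<in>P. if q = p then S q else 0)"
      using p by (intro sum.cong) (auto simp: mat_unit_def)
    also have "\<dots> = S p" using p by simp
    finally show "S p = (\<lambda>p\<in>P. \<Sum>q\<in>P. (\<lambda>p\<in>P. S q * mat_unit b (fst q) (snd q) p) p) p"
      using p by simp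
  qed auto
  hence "\<iota> S = (\<Oplus>q\<in>P. \<iota> (\<lambda>p\<in>P. S q * mat_unit b (fst q) (snd q) p))"
    using \<iota>_sum[of P "\<lambda>q. \<lambda>p\<in>P. S q * mat_unit b (fst q) (snd q) p"] by simp
  thus ?thesis by (simp add: e_def \<iota>_smult)
qed

end

context matrix_units
begin

lemma \<iota>_sandwich_expand:
  assumes "S \<in> extensional P" "T \<in> extensional P" "v \<in> carrier A"
  shows "\<iota> S \<otimes> (v \<otimes> \<iota> T) =
    (\<Oplus>x\<in>P. \<Oplus>y\<in>P. (S x * T y) \<odot> (e (fst x) (snd x) \<otimes> (v \<otimes> e (fst y) (snd y))))"
proof -
  let ?e = "\<lambda>x. e (fst x) (snd x)"
  have "v \<otimes> \<iota> T = (\<Oplus>y\<in>P. T y \<odot> (v \<otimes> ?e y))"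
    unfolding \<iota>_expand[OF assms(2)] using assms(3)
    by (subst finsum_rdistr) (auto simp: smult_mult_right)
  hence "\<iota> S \<otimes> (v \<otimes> \<iota> T) = (\<Oplus>x\<in>P. S x \<odot> ?e x) \<otimes> (\<Oplus>y\<in>P. T y \<odot> (v \<otimes> ?e y))"
    using \<iota>_expand[OF assms(1)] by simp
  also have "\<dots> = (\<Oplus>x\<in>P. (S x \<odot> ?e x) \<otimes> (\<Oplus>y\<in>P. T y \<odot> (v \<otimes> ?e y)))"
    using assms(3) by (intro finsum_ldistr finsum_closed) auto
  also have "\<dots> = (\<Oplus>x\<in>P. \<Oplus>y\<in>P. (S x * T y) \<odot> (?e x \<otimes> (v \<otimes> ?e y)))"
  proof (intro finsum_cong' refl)
    fix x assume "x \<in> P"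
    show "(S x \<odot> ?e x) \<otimes> (\<Oplus>y\<in>P. T y \<odot> (v \<otimes> ?e y)) =
        (\<Oplus>y\<in>P. (S x * T y) \<odot> (?e x \<otimes> (v \<otimes> ?e y)))"
      using assms(3)
      by (subst finsum_rdistr)
        (auto simp: smult_mult_left smult_mult_right smult_smult mult.commute)
  qed (use assms(3) in \<open>auto intro!: finsum_closed\<close>)
  finally show ?thesis .
qed

text \<open>Both sides are values of one linear map on the tensor square of the matrices, and the assumption on
  the coefficients says that the arguments agree.\<close>

lemma complete_family_sandwich:
  assumes "finite K" "\<And>k. k \<in> K \<Longrightarrow> S k \<in> extensional P \<and> T k \<in> extensional P"
    and v: "v \<in> carrier A"
    and c: "\<And>x y. x \<in> P \<Longrightarrow> y \<in> P \<Longrightarrow> (\<Sum>k\<in>K. S k x * T k y) = (if x = y then c else 0)"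
  shows "(\<Oplus>k\<in>K. \<iota> (S k) \<otimes> (v \<otimes> \<iota> (T k))) =
    c \<odot> (\<Oplus>x\<in>P. e (fst x) (snd x) \<otimes> (v \<otimes> e (fst x) (snd x)))"
proof -
  define E where "E = (\<lambda>x y. e (fst x) (snd x) \<otimes> (v \<otimes> e (fst y) (snd y)))"
  have E [simp]: "E x y \<in> carrier A" for x y using v by (simp add: E_def)
  have P: "finite P" by simp
  have "(\<Oplus>k\<in>K. \<iota> (S k) \<otimes> (v \<otimes> \<iota> (T k))) =
      (\<Oplus>k\<in>K. \<Oplus>x\<in>P. \<Oplus>y\<in>P. (S k x * T k y) \<odot> E x y)"
    using assms(2) v
    by (intro finsum_cong' refl) (auto simp: \<iota>_sandwich_expand E_def intro!: finsum_closed)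
  also have "\<dots> = (\<Oplus>x\<in>P. \<Oplus>k\<in>K. \<Oplus>y\<in>P. (S k x * T k y) \<odot> E x y)"
    by (intro finsum_exchange assms(1) P) (auto intro!: finsum_closed)
  also have "\<dots> = (\<Oplus>x\<in>P. \<Oplus>y\<in>P. \<Oplus>k\<in>K. (S k x * T k y) \<odot> E x y)"
    by (intro finsum_cong' refl finsum_exchange assms(1) P) (auto intro!: finsum_closed)
  also have "\<dots> = (\<Oplus>x\<in>P. c \<odot> E x x)"
  proof (intro finsum_cong' refl)
    fix x assume x: "x \<in> P"
    have "(\<Oplus>y\<in>P. \<Oplus>k\<in>K. (S k x * T k y) \<odot> E x y) = (\<Oplus>y\<in>P. if y = x then c \<odot> E x y else \<zero>)"
    proof (intro finsum_cong' refl)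
      fix y assume y: "y \<in> P"
      have "(\<Oplus>k\<in>K. (S k x * T k y) \<odot> E x y) = (\<Sum>k\<in>K. S k x * T k y) \<odot> E x y"
        by (rule sum_smult[symmetric, OF assms(1) E])
      also have "\<dots> = (if y = x then c \<odot> E x y else \<zero>)" using c[OF x y] by auto
      finally show "(\<Oplus>k\<in>K. (S k x * T k y) \<odot> E x y) = (if y = x then c \<odot> E x y else \<zero>)" .
    qed auto
    also have "\<dots> = c \<odot> E x x"
      using x by (intro add.finprod_singleton_swap P) auto
    finally show "(\<Oplus>y\<in>P. \<Oplus>k\<in>K. (S k x * T k y) \<odot> E x y) = c \<odot> E x x" .
  qed auto
  also have "\<dots> = c \<odot> (\<Oplus>x\<in>P. E x x)"
    by (intro smult_finsum[symmetric] P) auto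
  finally show ?thesis by (simp add: E_def)
qed

lemma \<iota>_star_mult:
  assumes "S \<in> extensional P" "T \<in> extensional P"
  shows "star A (\<iota> S) \<otimes> \<iota> T = \<iota> (\<lambda>(i, j)\<in>P. \<Sum>k=1..b. cnj (S (k, i)) * T (k, j))"
    and "\<iota> S \<otimes> star A (\<iota> T) = \<iota> (\<lambda>(i, j)\<in>P. \<Sum>k=1..b. S (i, k) * cnj (T (j, k)))"
proof -
  have "star A (\<iota> S) \<otimes> \<iota> T =
      \<iota> (\<lambda>(i, j)\<in>P. \<Sum>k=1..b. (\<lambda>(i, j)\<in>P. cnj (S (j, i))) (i, k) * T (k, j))"
    unfolding \<iota>_star[OF assms(1)] by (intro \<iota>_mult assms restrict_extensional)
  also have "(\<lambda>(i, j)\<in>P. \<Sum>k=1..b. (\<lambda>(i, j)\<in>P. cnj (S (j, i))) (i, k) * T (k, j)) =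
      (\<lambda>(i, j)\<in>P. \<Sum>k=1..b. cnj (S (k, i)) * T (k, j))"
    by (intro restrict_ext) auto
  finally show "star A (\<iota> S) \<otimes> \<iota> T = \<iota> (\<lambda>(i, j)\<in>P. \<Sum>k=1..b. cnj (S (k, i)) * T (k, j))" .
  have "\<iota> S \<otimes> star A (\<iota> T) =
      \<iota> (\<lambda>(i, j)\<in>P. \<Sum>k=1..b. S (i, k) * (\<lambda>(i, j)\<in>P. cnj (T (j, i))) (k, j))"
    unfolding \<iota>_star[OF assms(2)] by (intro \<iota>_mult assms restrict_extensional)
  also have "(\<lambda>(i, j)\<in>P. \<Sum>k=1..b. S (i, k) * (\<lambda>(i, j)\<in>P. cnj (T (j, i))) (k, j)) =
      (\<lambda>(i, j)\<in>P. \<Sum>k=1..b. S (i, k) * cnj (T (j, k)))"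
    by (intro restrict_ext) auto
  finally show "\<iota> S \<otimes> star A (\<iota> T) = \<iota> (\<lambda>(i, j)\<in>P. \<Sum>k=1..b. S (i, k) * cnj (T (j, k)))" .
qed

lemma unitary_\<iota>:
  assumes "S \<in> extensional P"
    and row: "\<And>i j. i \<in> {1..b} \<Longrightarrow> j \<in> {1..b} \<Longrightarrow> (\<Sum>k=1..b. S (i, k) * cnj (S (j, k))) = of_bool (i = j)"
    and col: "\<And>i j. i \<in> {1..b} \<Longrightarrow> j \<in> {1..b} \<Longrightarrow> (\<Sum>k=1..b. cnj (S (k, i)) * S (k, j)) = of_bool (i = j)"
  shows "unitary A (\<iota> S)"
proof -
  have "(\<lambda>(i, j)\<in>P. \<Sum>k=1..b. cnj (S (k, i)) * S (k, j)) = (\<lambda>(i, j)\<in>P. of_bool (i = j))"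
    by (intro restrict_ext) (auto simp: col)
  moreover have "(\<lambda>(i, j)\<in>P. \<Sum>k=1..b. S (i, k) * cnj (S (j, k))) = (\<lambda>(i, j)\<in>P. of_bool (i = j))"
    by (intro restrict_ext) (auto simp: row)
  ultimately show ?thesis
    unfolding unitary_def \<iota>_star_mult[OF assms(1) assms(1)] using assms(1) \<iota>_one by simp
qed

end


section \<open>The Brown algebra as a corner\<close>

locale brown_units = matrix_units A b \<iota> for A :: "'a cstar_algebra" (structure) and b \<iota>
begin

abbreviation "C \<equiv> brown_algebra b A \<iota>"
abbreviation "M \<equiv> mat_algebra b C"

lemma corner_simps [simp]:
  "x \<otimes>\<^bsub>C\<^esub> y = x \<otimes> y" "x \<oplus>\<^bsub>C\<^esub> y = x \<oplus> y" "\<zero>\<^bsub>C\<^esub> = \<zero>" "\<one>\<^bsub>C\<^esub> = e 1 1" "star C x = star A x"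
  by (simp_all add: brown_algebra_def corner_def e_def)

declare b_pos [simp]

text \<open>In this form, membership in the corner is an equation, so closure properties reduce to ring
  identities.\<close>

lemma in_corner_iff: "x \<in> carrier C \<longleftrightarrow> x \<in> carrier A \<and> e 1 1 \<otimes> x \<otimes> e 1 1 = x"
proof -
  have "e 1 1 \<otimes> (e 1 1 \<otimes> y \<otimes> e 1 1) \<otimes> e 1 1 = e 1 1 \<otimes> y \<otimes> e 1 1" if "y \<in> carrier A" for y
  proof -
    have "e 1 1 \<otimes> (e 1 1 \<otimes> y \<otimes> e 1 1) \<otimes> e 1 1 = (e 1 1 \<otimes> e 1 1) \<otimes> y \<otimes> (e 1 1 \<otimes> e 1 1)"
      using that by (simp add: m_assoc)
    thus ?thesis by (simp add: e_mult)
  qed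
  thus ?thesis
    by (auto simp: brown_algebra_def corner_def e_def[symmetric]) metis+
qed

lemma abelian_monoid_corner: "abelian_monoid C"
  by (rule abelian_monoidI) (auto simp: in_corner_iff l_distr r_distr a_ac)

lemma finsum_corner:
  assumes "finite F" "f \<in> F \<rightarrow> carrier C"
  shows "finsum C f F = finsum A f F"
proof -
  interpret C: abelian_monoid C by (rule abelian_monoid_corner)
  show ?thesis
    using assms
  proof (induction F rule: finite_induct)
    case empty
    show ?case using C.finsum_empty[of f] by simp
  next
    case (insert x F)
    hence "f \<in> F \<rightarrow> carrier A" "f x \<in> carrier A" by (auto simp: in_corner_iff)
    thus ?case using insert by (simp add: Pi_def)
  qed
qed

lemma brown_matrix_apply:
  "i \<in> {1..b} \<Longrightarrow> j \<in> {1..b} \<Longrightarrow> brown_matrix b A \<iota> x (i, j) = e 1 i \<otimes> x \<otimes> e j 1"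
  by (simp add: brown_matrix_def e_def)

lemma brown_matrix_in_corner:
  assumes "x \<in> carrier A" "i \<in> {1..b}" "j \<in> {1..b}"
  shows "e 1 i \<otimes> x \<otimes> e j 1 \<in> carrier C"
proof -
  have "e 1 1 \<otimes> (e 1 i \<otimes> x \<otimes> e j 1) \<otimes> e 1 1 = (e 1 1 \<otimes> e 1 i) \<otimes> x \<otimes> (e j 1 \<otimes> e 1 1)"
    using assms by (simp add: m_assoc)
  thus ?thesis using assms by (simp add: in_corner_iff e_mult)
qed

lemma brown_matrix_one: "brown_matrix b A \<iota> \<one> = \<one>\<^bsub>M\<^esub>"
  by (auto simp: brown_matrix_def mat_algebra_def e_def[symmetric] e_mult intro!: restrict_ext)

lemma brown_matrix_star:
  "x \<in> carrier A \<Longrightarrow> star M (brown_matrix b A \<iota> x) = brown_matrix b A \<iota> (star A x)"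
  by (auto simp: brown_matrix_def mat_algebra_def e_def[symmetric] star_mult e_star m_assoc
      intro!: restrict_ext)

text \<open>The inner sum produces \<open>e 1 1 + \<dots> + e b b\<close> between \<open>x\<close> and \<open>y\<close>, which is the unit.\<close>

lemma brown_matrix_mult:
  assumes "x \<in> carrier A" "y \<in> carrier A"
  shows "brown_matrix b A \<iota> x \<otimes>\<^bsub>M\<^esub> brown_matrix b A \<iota> y = brown_matrix b A \<iota> (x \<otimes> y)"
proof -
  have "(\<Oplus>\<^bsub>C\<^esub>k\<in>{1..b}. brown_matrix b A \<iota> x (i, k) \<otimes>\<^bsub>C\<^esub> brown_matrix b A \<iota> y (k, j)) =
      e 1 i \<otimes> (x \<otimes> y) \<otimes> e j 1" if ij: "i \<in> {1..b}" "j \<in> {1..b}" for i j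
  proof -
    have eq: "brown_matrix b A \<iota> x (i, k) \<otimes>\<^bsub>C\<^esub> brown_matrix b A \<iota> y (k, j) =
        e 1 i \<otimes> (x \<otimes> e k k \<otimes> y) \<otimes> e j 1" if k: "k \<in> {1..b}" for k
    proof -
      have "e 1 i \<otimes> x \<otimes> e k 1 \<otimes> (e 1 k \<otimes> y \<otimes> e j 1) =
          e 1 i \<otimes> (x \<otimes> (e k 1 \<otimes> e 1 k) \<otimes> y) \<otimes> e j 1"
        using assms by (simp add: m_assoc)
      thus ?thesis using ij k by (simp add: brown_matrix_apply e_mult)
    qed
    have "(\<Oplus>\<^bsub>C\<^esub>k\<in>{1..b}. brown_matrix b A \<iota> x (i, k) \<otimes>\<^bsub>C\<^esub> brown_matrix b A \<iota> y (k, j)) =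
        (\<Oplus>k\<in>{1..b}. brown_matrix b A \<iota> x (i, k) \<otimes>\<^bsub>C\<^esub> brown_matrix b A \<iota> y (k, j))"
    proof (intro finsum_corner funcsetI finite_atLeastAtMost)
      fix k assume k: "k \<in> {1..b}"
      show "brown_matrix b A \<iota> x (i, k) \<otimes>\<^bsub>C\<^esub> brown_matrix b A \<iota> y (k, j) \<in> carrier C"
        unfolding eq[OF k] using assms ij by (intro brown_matrix_in_corner) auto
    qed
    also have "\<dots> = (\<Oplus>k\<in>{1..b}. e 1 i \<otimes> (x \<otimes> e k k \<otimes> y) \<otimes> e j 1)"
      using assms by (intro finsum_cong' refl eq) auto
    also have "\<dots> = e 1 i \<otimes> (x \<otimes> (\<Oplus>k\<in>{1..b}. e k k) \<otimes> y) \<otimes> e j 1"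
      using assms by (simp add: finsum_ldistr finsum_rdistr Pi_def)
    finally show ?thesis using assms by (simp add: e_sum)
  qed
  hence "brown_matrix b A \<iota> x \<otimes>\<^bsub>M\<^esub> brown_matrix b A \<iota> y =
      (\<lambda>(i, j)\<in>P. e 1 i \<otimes> (x \<otimes> y) \<otimes> e j 1)"
    unfolding mat_algebra_def monoid.select_convs by (intro restrict_ext) auto
  thus ?thesis by (simp add: brown_matrix_def e_def)
qed

lemma eval_word_brown_matrix:
  assumes "x \<in> carrier A"
  shows "eval_word M (brown_matrix b A \<iota> x) w = brown_matrix b A \<iota> (eval_word A x w)"
proof (induction w)
  case Nil
  show ?case by (simp add: eval_word_def brown_matrix_one)
next
  case (Cons l w)
  have "eval_letter M (brown_matrix b A \<iota> x) l = brown_matrix b A \<iota> (eval_letter A x l)"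
    using assms by (cases l) (simp_all add: brown_matrix_star)
  thus ?case
    using Cons assms by (simp add: eval_word_def brown_matrix_mult eval_word_closed[unfolded eval_word_def])
qed

text \<open>In the entry of the right-hand side at \<open>(i, j)\<close> only the summand \<open>x = (i, j)\<close> survives. It contributes
  \<open>e 1 i e i j v e i j e j 1 = e 1 j v e i 1\<close>, the entry of the matrix of \<open>v\<close> at \<open>(j, i)\<close>.\<close>

lemma transpose_brown_matrix:
  assumes v: "v \<in> carrier A"
  shows "mat_transpose b (brown_matrix b A \<iota> v) =
    brown_matrix b A \<iota> (\<Oplus>x\<in>P. e (fst x) (snd x) \<otimes> (v \<otimes> e (fst x) (snd x)))"
proof -
  let ?e = "\<lambda>x. e (fst x) (snd x)"
  have "e 1 i \<otimes> (\<Oplus>x\<in>P. ?e x \<otimes> (v \<otimes> ?e x)) \<otimes> e j 1 = e 1 j \<otimes> v \<otimes> e i 1"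
    if ij: "i \<in> {1..b}" "j \<in> {1..b}" for i j
  proof -
    have "e 1 i \<otimes> (\<Oplus>x\<in>P. ?e x \<otimes> (v \<otimes> ?e x)) \<otimes> e j 1 =
        (\<Oplus>x\<in>P. e 1 i \<otimes> (?e x \<otimes> (v \<otimes> ?e x)) \<otimes> e j 1)"
      using v by (simp add: finsum_ldistr finsum_rdistr Pi_def)
    also have "\<dots> = (\<Oplus>x\<in>P. if x = (i, j) then e 1 (snd x) \<otimes> v \<otimes> e (fst x) 1 else \<zero>)"
    proof (intro finsum_cong' refl)
      fix x assume x: "x \<in> P"
      have "e 1 i \<otimes> (?e x \<otimes> (v \<otimes> ?e x)) \<otimes> e j 1 = (e 1 i \<otimes> ?e x) \<otimes> v \<otimes> (?e x \<otimes> e j 1)"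
        using v by (simp add: m_assoc)
      also have "\<dots> = (if x = (i, j) then e 1 (snd x) \<otimes> v \<otimes> e (fst x) 1 else \<zero>)"
        using x ij v by (cases x) (auto simp: e_mult)
      finally show "e 1 i \<otimes> (?e x \<otimes> (v \<otimes> ?e x)) \<otimes> e j 1 =
          (if x = (i, j) then e 1 (snd x) \<otimes> v \<otimes> e (fst x) 1 else \<zero>)" .
    qed (use v in auto)
    also have "\<dots> = e 1 (snd (i, j)) \<otimes> v \<otimes> e (fst (i, j)) 1"
      using ij v by (intro add.finprod_singleton_swap) auto
    finally show ?thesis by simp
  qed
  hence "(\<lambda>(i, j)\<in>P. e 1 i \<otimes> (\<Oplus>x\<in>P. ?e x \<otimes> (v \<otimes> ?e x)) \<otimes> e j 1) =
      mat_transpose b (brown_matrix b A \<iota> v)"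
    unfolding mat_transpose_def by (intro restrict_ext) (auto simp: brown_matrix_apply)
  thus ?thesis by (simp add: brown_matrix_def e_def)
qed

text \<open>Traciality moves \<open>e i 1\<close> around, which turns the diagonal entries into \<open>x e i i\<close>. Their sum is \<open>x\<close>.\<close>

lemma state_brown_matrix:
  assumes "star_prob_space A \<phi>" "tracial A \<phi>" "x \<in> carrier A"
  shows "mat_state b (brown_state b \<phi>) (brown_matrix b A \<iota> x) = \<phi> x"
proof -
  interpret star_state A \<phi> using assms(1) by (simp add: star_state_iff)
  have "\<phi> (e 1 i \<otimes> x \<otimes> e i 1) = \<phi> (x \<otimes> e i i)" if i: "i \<in> {1..b}" for i
  proof -
    have "\<phi> (e 1 i \<otimes> (x \<otimes> e i 1)) = \<phi> (x \<otimes> e i 1 \<otimes> e 1 i)"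
      using assms(2,3) by (simp add: tracial_def)
    also have "x \<otimes> e i 1 \<otimes> e 1 i = x \<otimes> e i i"
      using assms(3) i by (simp add: m_assoc e_mult)
    finally show ?thesis using assms(3) by (simp add: m_assoc)
  qed
  hence "mat_state b (brown_state b \<phi>) (brown_matrix b A \<iota> x) = (\<Sum>i=1..b. \<phi> (x \<otimes> e i i))"
    using b_pos unfolding mat_state_def brown_state_def
    by (simp add: brown_matrix_apply sum_distrib_left[symmetric])
  also have "\<dots> = \<phi> (x \<otimes> (\<Oplus>i\<in>{1..b}. e i i))"
    using assms(3) by (simp add: finsum_rdistr state_finsum)
  finally show ?thesis using assms(3) by (simp add: e_sum)
qed

theorem star_distribution_transpose:
  assumes "star_prob_space A \<phi>" "tracial A \<phi>" "v \<in> carrier A"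
  shows "star_distribution M (mat_state b (brown_state b \<phi>)) (mat_transpose b (brown_matrix b A \<iota> v)) =
    star_distribution A \<phi> (\<Oplus>x\<in>P. e (fst x) (snd x) \<otimes> (v \<otimes> e (fst x) (snd x)))"
proof -
  have "(\<Oplus>x\<in>P. e (fst x) (snd x) \<otimes> (v \<otimes> e (fst x) (snd x))) \<in> carrier A"
    using assms(3) by (auto intro!: finsum_closed)
  thus ?thesis
    unfolding star_distribution_def transpose_brown_matrix[OF assms(3)]
    by (simp add: eval_word_brown_matrix state_brown_matrix[OF assms(1,2)])
qed

end

section \<open>The transpose of the canonical unitary\<close>

text \<open>The trace of \<open>W\<^sub>k\<^sup>* W\<^sub>l\<close> and the trace of \<open>cnj W\<^sub>k (cnj W\<^sub>l)\<^sup>*\<close> are the same sum over all entries of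
  \<open>W\<^sub>k\<close> and \<open>W\<^sub>l\<close>, so one orthogonality relation serves both sides of \<open>v\<close>.\<close>

lemma (in matrix_units) weyl_twists_free:
  assumes \<phi>: "star_prob_space A \<phi>"
    and trace: "\<And>S. S \<in> extensional P \<Longrightarrow> \<phi> (\<iota> S) = normalized_trace b S"
    and free: "free_family A \<phi> UNIV (case_bool (\<iota> ` extensional P) E)"
    and v: "haar_unitary A \<phi> v" "\<And>k::int. v [^] k \<in> E"
  shows "free_unitaries A \<phi> {1..b\<^sup>2} (\<lambda>k. \<iota> (weyl b (k - 1)) \<otimes>
    (v \<otimes> \<iota> (\<lambda>(i, j)\<in>P. cnj (weyl b (k - 1) (i, j)))))"
proof -
  interpret star_state A \<phi> using \<phi> by (simp add: star_state_iff)
  let ?W' = "\<lambda>k. \<lambda>(i, j)\<in>P. cnj (weyl b k (i, j))"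
  have W: "weyl b k \<in> extensional P" "?W' k \<in> extensional P" for k
    by (simp_all add: weyl_def)
  interpret free_from_Haar A \<phi> "\<iota> ` extensional P" E v
  proof
    fix x y assume "x \<in> \<iota> ` extensional P" "y \<in> \<iota> ` extensional P"
    then obtain S T where ST: "S \<in> extensional P" "T \<in> extensional P" "x = \<iota> S" "y = \<iota> T"
      by blast
    show "x \<otimes> y \<in> \<iota> ` extensional P"
      unfolding ST(3,4) \<iota>_mult[OF ST(1,2)] by (intro imageI restrict_extensional)
  next
    fix x assume "x \<in> \<iota> ` extensional P"
    then obtain S where S: "S \<in> extensional P" "x = \<iota> S" by blast
    show "star A x \<in> \<iota> ` extensional P"
      unfolding S(2) \<iota>_star[OF S(1)] by (intro imageI restrict_extensional)
  next
    fix x c assume "x \<in> \<iota> ` extensional P"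
    then obtain S where S: "S \<in> extensional P" "x = \<iota> S" by blast
    let ?I = "\<lambda>(i, j)\<in>P. of_bool (i = j)"
    have "x \<oplus> c \<odot> \<one> = \<iota> S \<oplus> \<iota> (\<lambda>p\<in>P. c * ?I p)"
      using \<iota>_smult[of ?I c] by (simp only: S \<iota>_one restrict_extensional)
    also have "\<dots> = \<iota> (\<lambda>p\<in>P. S p + (\<lambda>p\<in>P. c * ?I p) p)"
      by (intro \<iota>_add S restrict_extensional)
    finally have "x \<oplus> c \<odot> \<one> = \<iota> (\<lambda>p\<in>P. S p + (\<lambda>p\<in>P. c * ?I p) p)" .
    thus "x \<oplus> c \<odot> \<one> \<in> \<iota> ` extensional P"
      by (simp only:) (intro imageI restrict_extensional)
  qed (use free v in auto)
  show ?thesis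
  proof (rule twisted_Haar_free_unitaries)
    fix k assume "k \<in> {1..b\<^sup>2}"
    show "\<iota> (weyl b (k - 1)) \<in> \<iota> ` extensional P \<and> unitary A (\<iota> (weyl b (k - 1)))"
      using W by (intro conjI imageI unitary_\<iota> weyl_unitary_row weyl_unitary_col b_pos)
    have "unitary A (\<iota> (?W' (k - 1)))"
    proof (intro unitary_\<iota> W)
      fix i j assume ij: "i \<in> {1..b}" "j \<in> {1..b}"
      have "(\<Sum>r=1..b. ?W' (k - 1) (i, r) * cnj (?W' (k - 1) (j, r))) =
          (\<Sum>r=1..b. weyl b (k - 1) (j, r) * cnj (weyl b (k - 1) (i, r)))"
        using ij by (intro sum.cong) auto
      thus "(\<Sum>r=1..b. ?W' (k - 1) (i, r) * cnj (?W' (k - 1) (j, r))) = of_bool (i = j)"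
        using weyl_unitary_row[OF b_pos ij(2,1)] by auto
      have "(\<Sum>r=1..b. cnj (?W' (k - 1) (r, i)) * ?W' (k - 1) (r, j)) =
          (\<Sum>r=1..b. cnj (weyl b (k - 1) (r, j)) * weyl b (k - 1) (r, i))"
        using ij by (intro sum.cong) auto
      thus "(\<Sum>r=1..b. cnj (?W' (k - 1) (r, i)) * ?W' (k - 1) (r, j)) = of_bool (i = j)"
        using weyl_unitary_col[OF b_pos ij(2,1)] by auto
    qed
    thus "\<iota> (?W' (k - 1)) \<in> \<iota> ` extensional P \<and> unitary A (\<iota> (?W' (k - 1)))"
      using W by blast
  next
    fix k l assume kl: "k \<in> {1..b\<^sup>2}" "l \<in> {1..b\<^sup>2}" "k \<noteq> l"
    hence "l - 1 < b\<^sup>2" "k - 1 < b\<^sup>2" "k - 1 \<noteq> l - 1" by auto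
    note orth = weyl_orthogonal[OF b_pos this(2,1,3)]
    have "(\<Sum>i=1..b. \<Sum>j=1..b. cnj (weyl b (k - 1) (j, i)) * weyl b (l - 1) (j, i)) = 0"
      using orth by (subst sum.swap)
    thus "\<phi> (star A (\<iota> (weyl b (k - 1))) \<otimes> \<iota> (weyl b (l - 1))) = 0"
      using W by (simp add: \<iota>_star_mult trace mat_state_def)
    have "(\<Sum>i=1..b. \<Sum>j=1..b. ?W' (k - 1) (i, j) * cnj (?W' (l - 1) (i, j))) =
        (\<Sum>i=1..b. \<Sum>j=1..b. cnj (weyl b (k - 1) (i, j)) * weyl b (l - 1) (i, j))"
      by (intro sum.cong) auto
    thus "\<phi> (\<iota> (?W' (k - 1)) \<otimes> star A (\<iota> (?W' (l - 1)))) = 0"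
      using W orth by (simp add: \<iota>_star_mult trace mat_state_def)
  qed
qed

text \<open>The completeness of the Weyl matrices, applied to \<open>v\<close>: both sides arise from the same tensor.
  The Weyl matrices are numbered from 0, the unitaries from 1.\<close>

lemma (in matrix_units) sum_of_weyl_twists:
  assumes "v \<in> carrier A"
  shows "(1 / of_nat b) \<odot> (\<Oplus>k\<in>{1..b\<^sup>2}. \<iota> (weyl b (k - 1)) \<otimes>
      (v \<otimes> \<iota> (\<lambda>(i, j)\<in>P. cnj (weyl b (k - 1) (i, j))))) =
    (\<Oplus>x\<in>P. e (fst x) (snd x) \<otimes> (v \<otimes> e (fst x) (snd x)))"
proof -
  let ?W' = "\<lambda>k. \<lambda>(i, j)\<in>P. cnj (weyl b k (i, j))"
  have "(\<Oplus>k\<in>{1..b\<^sup>2}. \<iota> (weyl b (k - 1)) \<otimes> (v \<otimes> \<iota> (?W' (k - 1)))) =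
      of_nat b \<odot> (\<Oplus>x\<in>P. e (fst x) (snd x) \<otimes> (v \<otimes> e (fst x) (snd x)))"
  proof (rule complete_family_sandwich)
    fix x y assume xy: "x \<in> P" "y \<in> P"
    have "(\<Sum>k\<in>{1..b\<^sup>2}. weyl b (k - 1) x * ?W' (k - 1) y) =
        (\<Sum>k<b\<^sup>2. weyl b k x * cnj (weyl b k y))"
      using xy by (intro sum.reindex_bij_witness[of _ Suc "\<lambda>k. k - 1"]) (auto split: prod.splits)
    thus "(\<Sum>k\<in>{1..b\<^sup>2}. weyl b (k - 1) x * ?W' (k - 1) y) = (if x = y then of_nat b else 0)"
      using weyl_complete[OF b_pos, of "fst x" "snd x" "fst y" "snd y"] xy
      by (auto simp: prod_eq_iff)
  qed (use assms in \<open>auto simp: weyl_def\<close>)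
  thus ?thesis
    using assms b_pos by (simp add: smult_smult finsum_closed Pi_def)
qed

text \<open>The free product is a C*-algebra, whereas the unitaries are to live in a plain *-algebra.\<close>

definition forget_norm :: "'a cstar_algebra \<Rightarrow> 'a star_algebra" where
  "forget_norm A = star_algebra.truncate A"

lemma forget_norm_simps [simp]:
  "carrier (forget_norm A) = carrier A" "mult (forget_norm A) = mult A"
  "one (forget_norm A) = one A" "zero (forget_norm A) = zero A" "add (forget_norm A) = add A"
  "smult (forget_norm A) = smult A" "star (forget_norm A) = star A"
  by (simp_all add: forget_norm_def star_algebra.truncate_def)

text \<open>The two records have different types, so the axioms are unfolded down to statements about the
  fields, which the records share.\<close>

lemma star_algebra_forget_norm: "star_algebra A \<Longrightarrow> star_algebra (forget_norm A)"
  unfolding star_algebra_def star_algebra_axioms_def ring_def abelian_group_def abelian_monoid_def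
    abelian_group_axioms_def ring_axioms_def monoid_def comm_monoid_def comm_monoid_axioms_def
    comm_group_def group_def group_axioms_def Units_def module_def module_axioms_def
    forget_norm_simps partial_object.select_convs monoid.select_convs
  by assumption

lemma star_prob_space_forget_norm: "star_prob_space A \<phi> \<Longrightarrow> star_prob_space (forget_norm A) \<phi>"
  by (simp add: star_prob_space_def star_algebra_forget_norm)

lemma free_unitaries_forget_norm:
  "free_unitaries A \<phi> I u \<Longrightarrow> free_unitaries (forget_norm A) \<phi> I u"
proof -
  have "eval_letter (forget_norm A) x l = eval_letter A x l" for x l
    by (cases l) simp_all
  thus "free_unitaries A \<phi> I u \<Longrightarrow> free_unitaries (forget_norm A) \<phi> I u"
    by (simp add: free_unitaries_def unitary_def word_prod_def)
qed

theorem theorem16: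
  fixes b :: nat
    and A :: "'a cstar_algebra"
    and \<iota>1 :: "(nat \<times> nat \<Rightarrow> complex) \<Rightarrow> 'a"
    and \<iota>2 :: "(complex \<Rightarrow> complex) \<Rightarrow> 'a"
    and \<phi>b :: "'a \<Rightarrow> complex"
  defines "V \<equiv> brown_matrix b A \<iota>1 (\<iota>2 circle_id)"
    and "M \<equiv> mat_algebra b (brown_algebra b A \<iota>1)"
    and "\<Phi> \<equiv> mat_state b (brown_state b \<phi>b)"
  assumes "b \<ge> 1"
    and "cstar_free_product (mat_algebra b complex_algebra) circle_algebra A \<iota>1 \<iota>2"
    and "free_product_state (mat_algebra b complex_algebra) (normalized_trace b)
           circle_algebra haar_integral A \<iota>1 \<iota>2 \<phi>b"
    and "tracial A \<phi>b"
  shows "(\<exists>(B :: 'a star_algebra) \<psi> (u :: nat \<Rightarrow> 'a).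
            free_haar_unitaries B \<psi> {1..b\<^sup>2} u \<and>
            star_distribution M \<Phi> (mat_transpose b V) =
            star_distribution B \<psi> ((1 / of_nat b) \<odot>\<^bsub>B\<^esub> (\<Oplus>\<^bsub>B\<^esub>i\<in>{1..b\<^sup>2}. u i))) \<and>
         (\<forall>(B :: 'c star_algebra) \<psi> (u :: nat \<Rightarrow> 'c).
            free_haar_unitaries B \<psi> {1..b\<^sup>2} u \<longrightarrow>
            star_distribution M \<Phi> (mat_transpose b V) =
            star_distribution B \<psi> ((1 / of_nat b) \<odot>\<^bsub>B\<^esub> (\<Oplus>\<^bsub>B\<^esub>i\<in>{1..b\<^sup>2}. u i)))"
proof -
  have \<phi>b: "star_prob_space A \<phi>b" and hom: "\<iota>1 \<in> star_hom (mat_algebra b complex_algebra) A"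
      "\<iota>2 \<in> star_hom circle_algebra A"
    using assms(5,6) by (auto simp: free_product_state_def cstar_free_product_def)
  interpret star_state A \<phi>b using \<phi>b by (simp add: star_state_iff)
  interpret brown_units A b \<iota>1 by unfold_locales (use assms(4) hom in auto)
  note state = assms(6)[unfolded free_product_state_def mat_complex_carrier]
  let ?v = "\<iota>2 circle_id"
  have v: "haar_unitary A \<phi>b ?v" "\<And>k::int. ?v [^]\<^bsub>A\<^esub> k \<in> \<iota>2 ` carrier circle_algebra"
    using circle_id_powers[OF \<phi>b hom(2)] state by auto
  have vc: "?v \<in> carrier A" using v(1) by (simp add: haar_unitary_def)
  let ?u = "\<lambda>k. \<iota>1 (weyl b (k - 1)) \<otimes>\<^bsub>A\<^esub> (?v \<otimes>\<^bsub>A\<^esub> \<iota>1 (\<lambda>(i, j)\<in>{1..b} \<times> {1..b}. cnj (weyl b (k - 1) (i, j))))"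
  have free: "free_unitaries A \<phi>b {1..b\<^sup>2} ?u"
    using state v by (intro weyl_twists_free[OF \<phi>b]) auto
  have dist: "star_distribution M \<Phi> (mat_transpose b V) =
      star_distribution A \<phi>b ((1 / of_nat b) \<odot>\<^bsub>A\<^esub> (\<Oplus>\<^bsub>A\<^esub>k\<in>{1..b\<^sup>2}. ?u k))"
    unfolding V_def M_def \<Phi>_def star_distribution_transpose[OF \<phi>b assms(7) vc]
      sum_of_weyl_twists[OF vc] ..
  let ?B = "forget_norm A"
  have B: "star_prob_space ?B \<phi>b" and freeB: "free_unitaries ?B \<phi>b {1..b\<^sup>2} ?u"
    using star_prob_space_forget_norm[OF \<phi>b] free_unitaries_forget_norm[OF free] .
  have freeB: "free_haar_unitaries ?B \<phi>b {1..b\<^sup>2} ?u"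
    using B freeB by (intro star_state.free_unitaries_imp_free_haar) (simp add: star_state_iff)
  note universal = trans[OF dist free_unitaries_sum_distribution[OF \<phi>b free _ finite_atLeastAtMost]]
  show ?thesis
    by (intro conjI allI impI exI[of _ ?B] exI[of _ \<phi>b] exI[of _ ?u] freeB universal)
qed

end
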